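(* Let $\alpha,\beta,\gamma\in\mathbb{C}$. Consider the following list of functions $\tau(k,m)$ of $k\in\mathbb{Z}$, $m\in\gamma+\mathbb{Z}$, each attached to the indicated values of $(\alpha,\beta)$: (i) $\alpha-\beta=0$: $k$; (ii) $\alpha=1,\beta=0$: $km$; (iii) $\alpha=1,\beta=0$: $k^2$; (iv) $\alpha-\beta=2$: $k^3+2k^2m$; (v) $\alpha-\beta=3$: $k^3m+k^2m^2$; (vi) $\alpha-\beta=4$: $(4-\alpha)k^5+k^4m-6k^3m^2-4k^2m^3$; (vii) $\alpha=1,\beta=-4$: $12k^6+22k^5m+5k^4m^2-10k^3m^3-5k^2m^4$; (viii) $\alpha=5,\beta=0$: $2k^5m-5k^4m^2+10k^3m^3+5k^2m^4$; (ix) $\alpha=\frac{7+\sqrt{19}}{2},\ \beta=\frac{-5+\sqrt{19}}{2}$: $-\frac{22-5\sqrt{19}}{4}k^7-\frac{31-7\sqrt{19}}{2}k^6m-\frac{25-7\sqrt{19}}{2}k^5m^2-5k^4m^3+5k^3m^4+2k^2m^5$; (x) $\alpha=\frac{7-\sqrt{19}}{2},\ \beta=\frac{-5-\sqrt{19}}{2}$: $-\frac{22+5\sqrt{19}}{4}k^7-\frac{31+7\sqrt{19}}{2}k^6m-\frac{25+7\sqrt{19}}{2}k^5m^2-5k^4m^3+5k^3m^4+2k^2m^5$. Each function in the list is a non-trivial cocycle for the indicated $(\alpha,\beta)$, the two cocycles for $(\alpha,\beta)=(1,0)$ being linearly independent modulo coboundaries. Moreover, every polynomial cocycle for $(\alpha,\beta,\gamma)$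 is equivalent to a linear combination of the listed cocycles attached to that pair $(\alpha,\beta)$; in particular it is trivial if $(\alpha,\beta)$ matches no entry of the list.
   Context: $W_1$ is the Witt algebra over $\mathbb{C}$ with basis $\{e_k:k\in\mathbb{Z}\}$ and $[e_k,e_s]=(s-k)e_{k+s}$. The tensor module $T(\alpha,\gamma)$ has basis $\{v_m:m\in\gamma+\mathbb{Z}\}$ with $e_kv_m=(m+\alpha k)v_{m+k}$; $T(\beta,\gamma)$ has basis $\{w_m\}$ with $e_kw_m=(m+\beta k)w_{m+k}$. A weight-module extension $0\to T(\alpha,\gamma)\to M\to T(\beta,\gamma)\to0$ is described by a function $\tau:\mathbb{Z}\times(\gamma+\mathbb{Z})\to\mathbb{C}$ via $e_kw_m=(m+\beta k)w_{m+k}+\tau(k,m)v_{m+k}$. A cocycle for $(\alpha,\beta,\gamma)$ is a function $\tau$ with $\tau(0,m)=0$ for all $m$ (so that $M$ is a weight module) satisfying, for all $k,s\in\mathbb{Z}$ and $m\in\gamma+\mathbb{Z}$, $$(s-k)\tau(k+s,m)=(m+\beta s)\tau(k,m+s)-(m+\beta k)\tau(s,m+k)+(m+s+\alpha k)\tau(s,m)-(m+k+\alpha s)\tau(k,m).$$ A polynomial cocycle is a cocycle given by a polynomial in $k$ and $m$ with complex coefficients. A coboundary is a function of the form $\tau(k,m)=(m+\beta k)g(m+k)-(m+\alpha k)g(m)$ for some $g:\gamma+\mathbb{Z}\to\mathbb{C}$. Two cocycles are equivalent if they differ by a coboundary; a cocycle is trivial if it is a coboundary. *)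

theory Defs
  imports "HOL-Analysis.Analysis"
begin

(* A function on Z x (gamma + Z) is encoded as a function of type int => complex => complex.
   Every notion below only looks at second arguments in the coset of gamma; the values of
   such a function elsewhere are irrelevant. *)

definition weights :: "complex \<Rightarrow> complex set" where
  "weights \<gamma> = {\<gamma> + of_int n | n. True}"

definition cocycle :: "complex \<Rightarrow> complex \<Rightarrow> complex \<Rightarrow> (int \<Rightarrow> complex \<Rightarrow> complex) \<Rightarrow> bool" where
  "cocycle \<alpha> \<beta> \<gamma> \<tau> \<longleftrightarrow>
     (\<forall>m\<in>weights \<gamma>. \<tau> 0 m = 0) \<and>
     (\<forall>k s. \<forall>m\<in>weights \<gamma>.
        (of_int s - of_int k) * \<tau> (k + s) m =
            (m + \<beta> * of_int s) * \<tau> k (m + of_int s)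
          - (m + \<beta> * of_int k) * \<tau> s (m + of_int k)
          + (m + of_int s + \<alpha> * of_int k) * \<tau> s m
          - (m + of_int k + \<alpha> * of_int s) * \<tau> k m)"

definition polynomial_cocycle ::
    "complex \<Rightarrow> complex \<Rightarrow> complex \<Rightarrow> (int \<Rightarrow> complex \<Rightarrow> complex) \<Rightarrow> bool" where
  "polynomial_cocycle \<alpha> \<beta> \<gamma> \<tau> \<longleftrightarrow>
     cocycle \<alpha> \<beta> \<gamma> \<tau> \<and>
     (\<exists>(N :: nat) (c :: nat \<Rightarrow> nat \<Rightarrow> complex). \<forall>k. \<forall>m\<in>weights \<gamma>.
        \<tau> k m = (\<Sum>i\<le>N. \<Sum>j\<le>N. c i j * of_int k ^ i * m ^ j))"

definition coboundary :: "complex \<Rightarrow> complex \<Rightarrow> complex \<Rightarrow> (int \<Rightarrow> complex \<Rightarrow> complex) \<Rightarrow> bool" where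
  "coboundary \<alpha> \<beta> \<gamma> \<tau> \<longleftrightarrow>
     (\<exists>g :: complex \<Rightarrow> complex. \<forall>k. \<forall>m\<in>weights \<gamma>.
        \<tau> k m = (m + \<beta> * of_int k) * g (m + of_int k) - (m + \<alpha> * of_int k) * g m)"

definition equivalent_cocycles ::
    "complex \<Rightarrow> complex \<Rightarrow> complex \<Rightarrow> (int \<Rightarrow> complex \<Rightarrow> complex) \<Rightarrow> (int \<Rightarrow> complex \<Rightarrow> complex) \<Rightarrow> bool" where
  "equivalent_cocycles \<alpha> \<beta> \<gamma> \<tau> \<sigma> \<longleftrightarrow>
     cocycle \<alpha> \<beta> \<gamma> \<tau> \<and> cocycle \<alpha> \<beta> \<gamma> \<sigma> \<and> coboundary \<alpha> \<beta> \<gamma> (\<lambda>k m. \<tau> k m - \<sigma> k m)"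

definition trivial_cocycle ::
    "complex \<Rightarrow> complex \<Rightarrow> complex \<Rightarrow> (int \<Rightarrow> complex \<Rightarrow> complex) \<Rightarrow> bool" where
  "trivial_cocycle \<alpha> \<beta> \<gamma> \<tau> \<longleftrightarrow> cocycle \<alpha> \<beta> \<gamma> \<tau> \<and> coboundary \<alpha> \<beta> \<gamma> \<tau>"

datatype entry =
    Entry_i | Entry_ii | Entry_iii | Entry_iv | Entry_v
  | Entry_vi | Entry_vii | Entry_viii | Entry_ix | Entry_x

instance entry :: finite
proof
  have "(UNIV :: entry set) = {Entry_i, Entry_ii, Entry_iii, Entry_iv, Entry_v,
      Entry_vi, Entry_vii, Entry_viii, Entry_ix, Entry_x}"
    using entry.exhaust by blast
  then show "finite (UNIV :: entry set)"
    by (metis finite.emptyI finite_insert)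
qed

abbreviation sqrt19 :: complex where
  "sqrt19 \<equiv> complex_of_real (sqrt 19)"

primrec attached :: "entry \<Rightarrow> complex \<Rightarrow> complex \<Rightarrow> bool" where
  "attached Entry_i \<alpha> \<beta> \<longleftrightarrow> \<alpha> - \<beta> = 0"
| "attached Entry_ii \<alpha> \<beta> \<longleftrightarrow> \<alpha> = 1 \<and> \<beta> = 0"
| "attached Entry_iii \<alpha> \<beta> \<longleftrightarrow> \<alpha> = 1 \<and> \<beta> = 0"
| "attached Entry_iv \<alpha> \<beta> \<longleftrightarrow> \<alpha> - \<beta> = 2"
| "attached Entry_v \<alpha> \<beta> \<longleftrightarrow> \<alpha> - \<beta> = 3"
| "attached Entry_vi \<alpha> \<beta> \<longleftrightarrow> \<alpha> - \<beta> = 4"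
| "attached Entry_vii \<alpha> \<beta> \<longleftrightarrow> \<alpha> = 1 \<and> \<beta> = -4"
| "attached Entry_viii \<alpha> \<beta> \<longleftrightarrow> \<alpha> = 5 \<and> \<beta> = 0"
| "attached Entry_ix \<alpha> \<beta> \<longleftrightarrow> \<alpha> = (7 + sqrt19) / 2 \<and> \<beta> = (-5 + sqrt19) / 2"
| "attached Entry_x \<alpha> \<beta> \<longleftrightarrow> \<alpha> = (7 - sqrt19) / 2 \<and> \<beta> = (-5 - sqrt19) / 2"

primrec listed_poly :: "entry \<Rightarrow> complex \<Rightarrow> complex \<Rightarrow> complex \<Rightarrow> complex" where
  "listed_poly Entry_i \<alpha> k m = k"
| "listed_poly Entry_ii \<alpha> k m = k * m"
| "listed_poly Entry_iii \<alpha> k m = k^2"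
| "listed_poly Entry_iv \<alpha> k m = k^3 + 2 * k^2 * m"
| "listed_poly Entry_v \<alpha> k m = k^3 * m + k^2 * m^2"
| "listed_poly Entry_vi \<alpha> k m =
     (4 - \<alpha>) * k^5 + k^4 * m - 6 * k^3 * m^2 - 4 * k^2 * m^3"
| "listed_poly Entry_vii \<alpha> k m =
     12 * k^6 + 22 * k^5 * m + 5 * k^4 * m^2 - 10 * k^3 * m^3 - 5 * k^2 * m^4"
| "listed_poly Entry_viii \<alpha> k m =
     2 * k^5 * m - 5 * k^4 * m^2 + 10 * k^3 * m^3 + 5 * k^2 * m^4"
| "listed_poly Entry_ix \<alpha> k m =
     - ((22 - 5 * sqrt19) / 4) * k^7 - (31 - 7 * sqrt19) / 2 * k^6 * m
     - (25 - 7 * sqrt19) / 2 * k^5 * m^2 - 5 * k^4 * m^3 + 5 * k^3 * m^4 + 2 * k^2 * m^5"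
| "listed_poly Entry_x \<alpha> k m =
     - ((22 + 5 * sqrt19) / 4) * k^7 - (31 + 7 * sqrt19) / 2 * k^6 * m
     - (25 + 7 * sqrt19) / 2 * k^5 * m^2 - 5 * k^4 * m^3 + 5 * k^3 * m^4 + 2 * k^2 * m^5"

(* The parameter alpha is needed only for the entry with alpha - beta = 4. *)
definition listed :: "entry \<Rightarrow> complex \<Rightarrow> int \<Rightarrow> complex \<Rightarrow> complex" where
  "listed e \<alpha> = (\<lambda>k m. listed_poly e \<alpha> (of_int k) m)"

end

theory Submission
  imports Defs "HOL-Computational_Algebra.Polynomial"
begin

text \<open>A polynomial cocycle is determined by polynomial identities, since integer points are Zariski dense; so
it splits into homogeneous components, each of which is a cocycle over the complex numbers
(\<open>zero_by_density\<close>, \<open>homogeneous_parts\<close>). The terms linear in \<open>k\<close> give a form of Euler's identity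
(\<open>euler\<close>), by which every component is a coboundary except possibly the one of degree \<open>n + 1\<close> with
\<open>n = \<alpha> - \<beta>\<close> a natural number. There, for \<open>2 \<le> n\<close>, the cocycle is divisible by \<open>k\<^sup>2\<close>, and its
coefficients at \<open>k\<^sup>2, k\<^sup>3, k\<^sup>4, ...\<close> are the values of a cocycle on the vector fields \<open>x\<^sup>2 d/dx\<close>,
\<open>x\<^sup>3 d/dx\<close>, \<open>x\<^sup>4 d/dx\<close>, ... of a Lie algebra generated by the first two. Two coefficients therefore
determine the cocycle, and modulo the coboundary of \<open>m ^ n\<close> a single determinant (\<open>obstruction\<close>) remains
(\<open>zero_if_coeff_23_zero\<close>, \<open>cob_poly_multiple\<close>).\<close>

text \<open>The two generators are free up to two relations, which first appear at \<open>x ^ 6 d/dx\<close> and \<open>x ^ 8 d/dx\<close>.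
The first confines nontrivial classes with \<open>5 \<le> n\<close> to the parabola \<open>(n - 1 + 2 \<beta>)\<^sup>2 = 3 n + 1\<close>
(\<open>relation_degree_6\<close>); the second, available for \<open>7 \<le> n\<close>, excludes all of them
(\<open>obstruction_eq_0\<close>). This leaves exactly the listed values for \<open>n = 5, 6\<close> and one class for each
\<open>n = 2, 3, 4\<close>; the cases \<open>n = 0, 1\<close> are immediate (\<open>homogenize_reducible\<close>).\<close>

text \<open>Conversely, the listed cocycles have nonzero determinant. A coboundary uses an arbitrary function on
\<open>\<gamma> + \<int>\<close>, but such a function is forced to be a polynomial when the coboundary is one
(\<open>coboundary_function_polynomial\<close>), so comparison of degrees shows that coboundaries have determinant zero
(\<open>coboundary_imp_obstruction_eq_0\<close>). The entries with \<open>n \<le> 1\<close> are treated by comparing values at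
\<open>\<gamma>, \<gamma> + 1, \<gamma> + 2\<close>.\<close>

section \<open>Polynomial functions and density\<close>

definition poly_fun :: "(complex \<Rightarrow> complex) \<Rightarrow> bool" where
  "poly_fun f \<longleftrightarrow> (\<exists>p. \<forall>x. f x = poly p x)"

lemma poly_fun_const: "poly_fun (\<lambda>x. c)"
  unfolding poly_fun_def by (rule exI[of _ "[:c:]"]) simp

lemma poly_fun_id: "poly_fun (\<lambda>x. x)"
  unfolding poly_fun_def by (rule exI[of _ "[:0,1:]"]) simp

lemma poly_fun_add: "poly_fun f \<Longrightarrow> poly_fun g \<Longrightarrow> poly_fun (\<lambda>x. f x + g x)"
  unfolding poly_fun_def by (metis poly_add)

lemma poly_fun_diff: "poly_fun f \<Longrightarrow> poly_fun g \<Longrightarrow> poly_fun (\<lambda>x. f x - g x)"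
  unfolding poly_fun_def by (metis poly_diff)

lemma poly_fun_mult: "poly_fun f \<Longrightarrow> poly_fun g \<Longrightarrow> poly_fun (\<lambda>x. f x * g x)"
  unfolding poly_fun_def by (metis poly_mult)

lemma poly_fun_power: "poly_fun f \<Longrightarrow> poly_fun (\<lambda>x. f x ^ n)"
  unfolding poly_fun_def by (metis poly_power)

lemma poly_fun_sum: "(\<And>i. i \<in> A \<Longrightarrow> poly_fun (f i)) \<Longrightarrow> poly_fun (\<lambda>x. \<Sum>i\<in>A. f i x)"
  by (induction A rule: infinite_finite_induct) (auto intro: poly_fun_const poly_fun_add)

lemma poly_fun_poly:
  assumes "poly_fun f" shows "poly_fun (\<lambda>x. poly p (f x))"
proof -
  obtain q where "\<And>x. f x = poly q x"
    using assms unfolding poly_fun_def by blast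
  then show ?thesis
    unfolding poly_fun_def by (intro exI[of _ "pcompose p q"]) (simp add: poly_pcompose)
qed

lemmas poly_fun_intros =
  poly_fun_const poly_fun_id poly_fun_add poly_fun_diff poly_fun_mult poly_fun_power
  poly_fun_sum poly_fun_poly

lemma poly_fun_zero:
  assumes "poly_fun f" "infinite S" "\<And>x. x \<in> S \<Longrightarrow> f x = 0"
  shows "f x = 0"
proof -
  obtain p where p: "\<And>x. f x = poly p x"
    using assms(1) unfolding poly_fun_def by blast
  have "S \<subseteq> {x. poly p x = 0}"
    using assms(3) p by auto
  then have "p = 0"
    using assms(2) poly_roots_finite finite_subset by blast
  then show ?thesis using p by simp
qed

lemma infinite_int: "infinite (range (of_int :: int \<Rightarrow> complex))"
  by (simp add: finite_image_iff inj_on_def infinite_UNIV_int)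

lemma infinite_weights: "infinite (weights \<gamma>)"
proof -
  have "weights \<gamma> = range (\<lambda>n::int. \<gamma> + of_int n)"
    unfolding weights_def by auto
  then show ?thesis
    by (simp add: finite_image_iff inj_on_def infinite_UNIV_int)
qed

lemma weights_add_of_int: "m \<in> weights \<gamma> \<Longrightarrow> m + of_int k \<in> weights \<gamma>"
  unfolding weights_def by (auto intro: exI[of _ "_ + k"])

text \<open>An identity that is polynomial in each of its three variables may be checked on the Zariski-dense set
of integer points over the weights. This turns the cocycle condition on \<open>\<int> \<times> \<int> \<times> (\<gamma> + \<int>)\<close>
into an identity between polynomials.\<close>

lemma zero_by_density:
  fixes F :: "complex \<Rightarrow> complex \<Rightarrow> complex \<Rightarrow> complex"
  assumes "\<And>s m. poly_fun (\<lambda>k. F k s m)" "\<And>k m. poly_fun (\<lambda>s. F k s m)"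
    "\<And>k s. poly_fun (\<lambda>m. F k s m)"
  assumes zero: "\<And>k s m. m \<in> weights \<gamma> \<Longrightarrow> F (of_int k) (of_int s) m = 0"
  shows "F k s m = 0"
proof -
  have 1: "F (of_int k) (of_int s) m = 0" for k s m
    using poly_fun_zero[OF assms(3) infinite_weights] zero by blast
  have 2: "F (of_int k) s m = 0" for k s m
    using poly_fun_zero[OF assms(2) infinite_int, of _ m s] 1 by blast
  show ?thesis
    using poly_fun_zero[OF assms(1) infinite_int, of s m k] 2 by blast
qed

section \<open>The cocycle identity over the complex numbers\<close>

definition coboundary_of :: "complex \<Rightarrow> complex \<Rightarrow> (complex \<Rightarrow> complex) \<Rightarrow> complex \<Rightarrow> complex \<Rightarrow> complex" where
  "coboundary_of \<alpha> \<beta> g k m = (m + \<beta> * k) * g (m + k) - (m + \<alpha> * k) * g m"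

definition defect ::
    "complex \<Rightarrow> complex \<Rightarrow> (complex \<Rightarrow> complex \<Rightarrow> complex) \<Rightarrow> complex \<Rightarrow> complex \<Rightarrow> complex \<Rightarrow> complex" where
  "defect \<alpha> \<beta> T k s m =
     (m + \<beta> * s) * T k (m + s) - (m + \<beta> * k) * T s (m + k)
     + (m + s + \<alpha> * k) * T s m - (m + k + \<alpha> * s) * T k m - (s - k) * T (k + s) m"

definition cocycle_identity :: "complex \<Rightarrow> complex \<Rightarrow> (complex \<Rightarrow> complex \<Rightarrow> complex) \<Rightarrow> bool" where
  "cocycle_identity \<alpha> \<beta> T \<longleftrightarrow> (\<forall>k s m. defect \<alpha> \<beta> T k s m = 0)"

lemma defect_sum:
  "defect \<alpha> \<beta> (\<lambda>k m. \<Sum>i\<in>A. T i k m) k s m = (\<Sum>i\<in>A. defect \<alpha> \<beta> (T i) k s m)"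
  unfolding defect_def by (simp add: sum_subtractf sum.distrib sum_distrib_left)

lemma defect_lin:
  "defect \<alpha> \<beta> (\<lambda>k m. T k m - c * U k m) k s m = defect \<alpha> \<beta> T k s m - c * defect \<alpha> \<beta> U k s m"
  unfolding defect_def by algebra

lemma defect_scale:
  "defect \<alpha> \<beta> (\<lambda>k m. c * U k m) k s m = c * defect \<alpha> \<beta> U k s m"
  unfolding defect_def by algebra

lemma cocycle_identity_cob: "cocycle_identity \<alpha> \<beta> (coboundary_of \<alpha> \<beta> g)"
  unfolding cocycle_identity_def
proof (intro allI)
  fix k s m :: complex
  have "m + s + k = m + (k + s)" "m + k + s = m + (k + s)" by simp_all
  then show "defect \<alpha> \<beta> (coboundary_of \<alpha> \<beta> g) k s m = 0"
    unfolding defect_def coboundary_of_def by (simp add: algebra_simps)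
qed

lemma cocycle_identity_imp_cocycle:
  assumes "cocycle_identity \<alpha> \<beta> T" "\<And>m. T 0 m = 0"
  shows "cocycle \<alpha> \<beta> \<gamma> (\<lambda>k m. T (of_int k) m)"
  unfolding cocycle_def
proof (intro conjI ballI allI)
  fix k s :: int and m
  have "defect \<alpha> \<beta> T (of_int k) (of_int s) m = 0"
    using assms unfolding cocycle_identity_def by blast
  then show "(of_int s - of_int k) * T (of_int (k + s)) m =
            (m + \<beta> * of_int s) * T (of_int k) (m + of_int s)
          - (m + \<beta> * of_int k) * T (of_int s) (m + of_int k)
          + (m + of_int s + \<alpha> * of_int k) * T (of_int s) m
          - (m + of_int k + \<alpha> * of_int s) * T (of_int k) m"
    unfolding defect_def by simp
qed (use assms in auto)

section \<open>Homogeneous components\<close>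

text \<open>A homogeneous polynomial of degree \<open>d\<close> in \<open>k\<close> and \<open>m\<close> is
encoded by its value at \<open>m = 1\<close>, a polynomial in \<open>k\<close> of degree at most \<open>d\<close>;
this is the passage back.\<close>

definition homogenize :: "nat \<Rightarrow> complex poly \<Rightarrow> complex \<Rightarrow> complex \<Rightarrow> complex" where
  "homogenize d p k m = (\<Sum>i\<le>d. coeff p i * k ^ i * m ^ (d - i))"

lemma homogenize_one: "degree p \<le> d \<Longrightarrow> homogenize d p k 1 = poly p k"
  unfolding homogenize_def poly_altdef
  by (auto intro!: sum.mono_neutral_right intro: le_degree)

lemma homogenize_scale: "homogenize d p (c * k) (c * m) = c ^ d * homogenize d p k m"
proof -
  have "coeff p i * (c * k) ^ i * (c * m) ^ (d - i) = c ^ d * (coeff p i * k ^ i * m ^ (d - i))"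
    if "i \<le> d" for i
    using that by (simp add: power_mult_distrib flip: power_add)
  then show ?thesis
    unfolding homogenize_def sum_distrib_left by (intro sum.cong) auto
qed

lemma defect_homogenize_scale:
  "defect \<alpha> \<beta> (homogenize d p) (c * k) (c * s) (c * m) = c ^ Suc d * defect \<alpha> \<beta> (homogenize d p) k s m"
proof -
  have "c * m + c * s = c * (m + s)" "c * m + c * k = c * (m + k)" "c * k + c * s = c * (k + s)"
    by algebra+
  then show ?thesis
    unfolding defect_def by (simp add: homogenize_scale) (simp add: algebra_simps)
qed

lemma homogenize_diff: "homogenize d (p - smult c q) k m = homogenize d p k m - c * homogenize d q k m"
  unfolding homogenize_def by (simp add: sum_subtractf sum_distrib_left algebra_simps)

lemma poly_fun_homogenize:
  "poly_fun f \<Longrightarrow> poly_fun g \<Longrightarrow> poly_fun (\<lambda>x. homogenize d p (f x) (g x))"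
  unfolding homogenize_def by (intro poly_fun_intros)

lemma homogenize_decomp:
  fixes c :: "nat \<Rightarrow> nat \<Rightarrow> complex"
  obtains p where "\<And>d. degree (p d) \<le> d"
    "\<And>k m. (\<Sum>i\<le>N. \<Sum>j\<le>N. c i j * k ^ i * m ^ j) = (\<Sum>d\<le>2*N. homogenize d (p d) k m)"
proof -
  define c' where "c' i j = (if i \<le> N \<and> j \<le> N then c i j else 0)" for i j
  define p where "p d = (\<Sum>i\<le>d. monom (c' i (d - i)) i)" for d
  have cf: "coeff (p d) i = (if i \<le> d then c' i (d - i) else 0)" for d i
    unfolding p_def by (simp add: coeff_sum sum.delta)
  have deg: "degree (p d) \<le> d" for d
    by (rule degree_le) (simp add: cf)
  have "(\<Sum>i\<le>N. \<Sum>j\<le>N. c i j * k ^ i * m ^ j) = (\<Sum>d\<le>2*N. homogenize d (p d) k m)" for k m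
  proof -
    have "(\<Sum>i\<le>N. \<Sum>j\<le>N. c i j * k ^ i * m ^ j)
        = (\<Sum>(i,j)\<in>{..N}\<times>{..N}. c' i j * k ^ i * m ^ j)"
      unfolding sum.cartesian_product by (intro sum.cong) (auto simp: c'_def)
    also have "\<dots> = (\<Sum>(i,j)\<in>{(i,j). i + j \<le> 2*N}. c' i j * k ^ i * m ^ j)"
    proof (rule sum.mono_neutral_left)
      show "finite {(i,j). i + j \<le> 2*N}"
        by (rule finite_subset[of _ "{..2*N}\<times>{..2*N}"]) auto
    qed (auto simp: c'_def split: if_splits)
    also have "\<dots> = (\<Sum>d\<le>2*N. \<Sum>i\<le>d. c' i (d - i) * k ^ i * m ^ (d - i))"
      by (rule sum.triangle_reindex_eq)
    also have "\<dots> = (\<Sum>d\<le>2*N. homogenize d (p d) k m)"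
      unfolding homogenize_def by (intro sum.cong) (auto simp: cf)
    finally show ?thesis .
  qed
  then show thesis using that deg by blast
qed

text \<open>The cocycle identity is homogeneous: rescaling all variables by \<open>c\<close> multiplies the
contribution of the component of degree \<open>d\<close> by \<open>c ^ Suc d\<close>. Comparing powers of \<open>c\<close>
separates the components.\<close>

lemma homogeneous_parts:
  assumes "cocycle_identity \<alpha> \<beta> (\<lambda>k m. \<Sum>d\<le>M. homogenize d (p d) k m)" and "d \<le> M"
  shows "cocycle_identity \<alpha> \<beta> (homogenize d (p d))"
  unfolding cocycle_identity_def
proof (intro allI)
  fix k s m
  \<comment> \<open>the coefficients of powers of \<open>c\<close>, shifted because the lowest power is \<open>c\<close> itself\<close>
  define e where "e j = (case j of 0 \<Rightarrow> 0 | Suc d \<Rightarrow> defect \<alpha> \<beta> (homogenize d (p d)) k s m)" for j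
  have "(\<Sum>j\<le>Suc M. e j * c ^ j) = 0" for c :: complex
  proof -
    have "(\<Sum>j\<le>Suc M. e j * c ^ j) = (\<Sum>d\<le>M. c ^ Suc d * defect \<alpha> \<beta> (homogenize d (p d)) k s m)"
      unfolding sum.atMost_Suc_shift by (simp add: e_def mult_ac)
    also have "\<dots> = defect \<alpha> \<beta> (\<lambda>k m. \<Sum>d\<le>M. homogenize d (p d) k m) (c * k) (c * s) (c * m)"
      unfolding defect_sum by (simp add: defect_homogenize_scale)
    also have "\<dots> = 0" using assms unfolding cocycle_identity_def by blast
    finally show ?thesis .
  qed
  then have "\<forall>i\<le>Suc M. e i = 0"
    using polyfun_eq_0[of e "Suc M"] by blast
  then have "e (Suc d) = 0" using assms(2) by blast
  then show "defect \<alpha> \<beta> (homogenize d (p d)) k s m = 0" by (simp add: e_def)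
qed

section \<open>Relations between the coefficients of a homogeneous cocycle\<close>

lemma coeff_pCons2_mult_Suc:
  "coeff ([:u, v:] * f) (Suc q) = u * coeff f (Suc q) + v * coeff f q"
  by simp

lemma coeff_shift_power:
  "coeff ([:c, 1:] ^ n) i = of_nat (n choose i) * (c :: complex) ^ (n - i)"
proof (cases "i \<le> n")
  case False
  then show ?thesis
    by (intro trans[OF coeff_eq_0]) (auto simp: degree_linear_power binomial_eq_0)
qed (simp add: coeff_linear_poly_power)

text \<open>Setting \<open>m = 1\<close> loses nothing for a homogeneous cocycle. Read as an identity between
polynomials in \<open>k\<close>, the cocycle condition then yields one identity in \<open>s\<close> for each positive power of \<open>k\<close>.\<close>

lemma coefficient_in_k:
  assumes "cocycle_identity \<alpha> \<beta> (homogenize d p)" and deg: "degree p \<le> d"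
  shows "(1 + \<beta> * s) * coeff p (Suc q) * (1 + s) ^ (d - Suc q)
    - (\<Sum>i\<le>d. coeff p i * (of_nat (d - i choose Suc q) + \<beta> * of_nat (d - i choose q)) * s ^ i)
    + (if q = 0 then \<alpha> * poly p s else 0)
    - ((1 + \<alpha> * s) * coeff p (Suc q) + coeff p q)
    = s * (\<Sum>i\<le>d. coeff p i * of_nat (i choose Suc q) * s ^ (i - Suc q))
      - (\<Sum>i\<le>d. coeff p i * of_nat (i choose q) * s ^ (i - q))"
proof -
  define A where "A = (\<Sum>i\<le>d. monom (coeff p i * (1 + s) ^ (d - i)) i)"
  define B where "B = (\<Sum>i\<le>d. smult (coeff p i * s ^ i) ([:1, 1:] ^ (d - i)))"
  define C where "C = (\<Sum>i\<le>d. smult (coeff p i) ([:s, 1:] ^ i))"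
  have A: "poly A k = homogenize d p k (1 + s)" for k
    unfolding A_def homogenize_def by (simp add: poly_sum poly_monom mult_ac)
  have B: "poly B k = homogenize d p s (1 + k)" for k
    unfolding B_def homogenize_def by (simp add: poly_sum)
  have C: "poly C k = poly p (k + s)" for k
    unfolding C_def homogenize_one[OF deg, symmetric] homogenize_def by (simp add: poly_sum add.commute)
  have "poly (smult (1 + \<beta> * s) A - [:1, \<beta>:] * B + [:(1 + s) * poly p s, \<alpha> * poly p s:]
      - [:1 + \<alpha> * s, 1:] * p - [:s, -1:] * C) k = 0" for k
  proof -
    have "defect \<alpha> \<beta> (homogenize d p) k s 1 = 0"
      using assms unfolding cocycle_identity_def by blast
    then show ?thesis
      unfolding defect_def homogenize_one[OF deg] by (simp add: A B C algebra_simps)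
  qed
  then have eq: "smult (1 + \<beta> * s) A - [:1, \<beta>:] * B + [:(1 + s) * poly p s, \<alpha> * poly p s:]
      - [:1 + \<alpha> * s, 1:] * p - [:s, -1:] * C = 0"
    using poly_all_0_iff_0 by blast
  have cA: "coeff A (Suc q) = coeff p (Suc q) * (1 + s) ^ (d - Suc q)"
    unfolding A_def using deg by (auto simp add: coeff_sum coeff_eq_0)
  have cB: "coeff B j = (\<Sum>i\<le>d. coeff p i * s ^ i * of_nat (d - i choose j))" for j
    unfolding B_def by (simp add: coeff_sum coeff_shift_power)
  have cC: "coeff C j = (\<Sum>i\<le>d. coeff p i * of_nat (i choose j) * s ^ (i - j))" for j
    unfolding C_def by (simp add: coeff_sum coeff_shift_power mult_ac)
  have "coeff (smult (1 + \<beta> * s) A - [:1, \<beta>:] * B + [:(1 + s) * poly p s, \<alpha> * poly p s:]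
      - [:1 + \<alpha> * s, 1:] * p - [:s, -1:] * C) (Suc q) = 0"
    unfolding eq by simp
  moreover have "coeff [:(1 + s) * poly p s, \<alpha> * poly p s:] (Suc q)
      = (if q = 0 then \<alpha> * poly p s else 0)"
    by (cases q) auto
  ultimately have "(1 + \<beta> * s) * coeff A (Suc q) - (coeff B (Suc q) + \<beta> * coeff B q)
      + (if q = 0 then \<alpha> * poly p s else 0) - ((1 + \<alpha> * s) * coeff p (Suc q) + coeff p q)
      - (s * coeff C (Suc q) - coeff C q) = 0"
    by (simp only: coeff_diff coeff_add coeff_smult coeff_pCons2_mult_Suc) simp
  moreover have "coeff B (Suc q) + \<beta> * coeff B q
      = (\<Sum>i\<le>d. coeff p i * (of_nat (d - i choose Suc q) + \<beta> * of_nat (d - i choose q)) * s ^ i)"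
    unfolding cB by (simp add: sum.distrib sum_distrib_left algebra_simps)
  ultimately show ?thesis
    unfolding cA cC by (simp add: algebra_simps)
qed

text \<open>The coboundary of \<open>m ^ n\<close> is homogeneous of degree \<open>Suc n\<close>; this is its
value at \<open>m = 1\<close>.\<close>

definition cob_poly :: "complex \<Rightarrow> complex \<Rightarrow> nat \<Rightarrow> complex poly" where
  "cob_poly \<alpha> \<beta> n = [:1, \<beta>:] * [:1, 1:] ^ n - [:1, \<alpha>:]"

lemma coeff_cob_poly_Suc:
  "coeff (cob_poly \<alpha> \<beta> n) (Suc i) =
     of_nat (n choose Suc i) + \<beta> * of_nat (n choose i) - (if i = 0 then \<alpha> else 0)"
proof -
  have "coeff [:1, \<alpha>:] (Suc i) = (if i = 0 then \<alpha> else 0)" by (cases i) auto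
  then show ?thesis
    unfolding cob_poly_def coeff_diff coeff_pCons2_mult_Suc by (simp add: coeff_shift_power)
qed

lemma coeff_cob_poly_0: "coeff (cob_poly \<alpha> \<beta> n) 0 = 0"
  unfolding cob_poly_def by (simp add: coeff_shift_power flip: poly_0_coeff_0)

lemma degree_cob_poly: "degree (cob_poly \<alpha> \<beta> n) \<le> Suc n"
proof (rule degree_le, intro allI impI)
  fix i assume "Suc n < i"
  then obtain j where "i = Suc j" "n < j" by (metis Suc_lessE Suc_less_eq)
  then show "coeff (cob_poly \<alpha> \<beta> n) i = 0"
    by (simp add: coeff_cob_poly_Suc binomial_eq_0)
qed

lemma homogenize_cob_poly: "homogenize (Suc n) (cob_poly \<alpha> \<beta> n) k m = coboundary_of \<alpha> \<beta> (\<lambda>x. x ^ n) k m"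
proof -
  have nz: "homogenize (Suc n) (cob_poly \<alpha> \<beta> n) k m = coboundary_of \<alpha> \<beta> (\<lambda>x. x ^ n) k m" if "m \<noteq> 0" for m
  proof -
    have "homogenize (Suc n) (cob_poly \<alpha> \<beta> n) k m = m ^ Suc n * poly (cob_poly \<alpha> \<beta> n) (k / m)"
      using homogenize_scale[of "Suc n" "cob_poly \<alpha> \<beta> n" m "k / m" 1] that homogenize_one[OF degree_cob_poly] by simp
    also have "\<dots> = (m + \<beta> * k) * (m * (1 + k / m)) ^ n - (m + \<alpha> * k) * m ^ n"
    proof -
      have "m * (1 + \<beta> * (k / m)) = m + \<beta> * k" "m * (1 + \<alpha> * (k / m)) = m + \<alpha> * k"
        using that by (simp_all add: field_simps)
      moreover have "m ^ Suc n * poly (cob_poly \<alpha> \<beta> n) (k / m)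
          = m * (1 + \<beta> * (k / m)) * (m ^ n * (1 + k / m) ^ n) - m * (1 + \<alpha> * (k / m)) * m ^ n"
        unfolding cob_poly_def by (simp add: algebra_simps)
      ultimately show ?thesis by (simp only: power_mult_distrib)
    qed
    also have "m * (1 + k / m) = m + k" using that by (simp add: field_simps)
    finally show ?thesis unfolding coboundary_of_def .
  qed
  have "poly_fun (\<lambda>m. homogenize (Suc n) (cob_poly \<alpha> \<beta> n) k m - coboundary_of \<alpha> \<beta> (\<lambda>x. x ^ n) k m)"
    unfolding coboundary_of_def by (intro poly_fun_intros poly_fun_homogenize)
  moreover have "infinite (- {0::complex})"
    by (simp add: infinite_UNIV_char_0)
  ultimately have "homogenize (Suc n) (cob_poly \<alpha> \<beta> n) k m - coboundary_of \<alpha> \<beta> (\<lambda>x. x ^ n) k m = 0"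
    by (rule poly_fun_zero) (use nz in auto)
  then show ?thesis by simp
qed

text \<open>The analogue of Euler's identity, obtained from the terms linear in \<open>k\<close>: the infinitesimal
action of the degree operator on cohomology is zero. A homogeneous cocycle is therefore a coboundary
unless its degree is \<open>\<alpha> - \<beta> + 1\<close>.\<close>

lemma euler:
  assumes "cocycle_identity \<alpha> \<beta> (homogenize (Suc n) p)" and deg: "degree p \<le> Suc n" and "coeff p 0 = 0"
  shows "smult (of_nat n - (\<alpha> - \<beta>)) p = smult (coeff p 1) (cob_poly \<alpha> \<beta> n)"
proof -
  have "(of_nat n - (\<alpha> - \<beta>)) * poly p s = coeff p 1 * poly (cob_poly \<alpha> \<beta> n) s" for s
  proof -
    have ps: "poly p s = (\<Sum>i\<le>Suc n. coeff p i * s ^ i)"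
      using homogenize_one[OF deg, symmetric] unfolding homogenize_def by simp
    have "(\<Sum>i\<le>Suc n. coeff p i * (of_nat (Suc n - i) + \<beta>) * s ^ i)
       = (\<Sum>i\<le>Suc n. (of_nat (Suc n) + \<beta>) * (coeff p i * s ^ i) - of_nat i * (coeff p i * s ^ i))"
      by (intro sum.cong refl) (simp add: of_nat_diff algebra_simps)
    also have "\<dots> = (of_nat (Suc n) + \<beta>) * poly p s - (\<Sum>i\<le>Suc n. of_nat i * (coeff p i * s ^ i))"
      unfolding ps by (simp only: sum_subtractf sum_distrib_left)
    finally have 1: "(\<Sum>i\<le>Suc n. coeff p i * (of_nat (Suc n - i) + \<beta>) * s ^ i) = \<dots>" .
    have 2: "s * (\<Sum>i\<le>Suc n. coeff p i * of_nat i * s ^ (i - 1))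
       = (\<Sum>i\<le>Suc n. of_nat i * (coeff p i * s ^ i))"
      unfolding sum_distrib_left
    proof (intro sum.cong refl)
      fix i show "s * (coeff p i * of_nat i * s ^ (i - 1)) = of_nat i * (coeff p i * s ^ i)"
        by (cases i) auto
    qed
    have "(1 + \<beta> * s) * coeff p 1 * (1 + s) ^ n
        - (\<Sum>i\<le>Suc n. coeff p i * (of_nat (Suc n - i) + \<beta>) * s ^ i)
        + \<alpha> * poly p s - (1 + \<alpha> * s) * coeff p 1
      = s * (\<Sum>i\<le>Suc n. coeff p i * of_nat i * s ^ (i - 1)) - poly p s"
      using coefficient_in_k[OF assms(1) deg, of s 0] assms(3) ps by simp
    then show ?thesis
      unfolding 1 2 cob_poly_def by (simp add: algebra_simps)
  qed
  then show ?thesis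
    by (simp add: poly_eq_poly_eq_iff[symmetric] fun_eq_iff)
qed

text \<open>The coefficients of \<open>k ^ a\<close> and \<open>k ^ b\<close> are, up to factorials, the values of the cocycle on the vector
fields \<open>x ^ a d/dx\<close> and \<open>x ^ b d/dx\<close>, whose bracket is a multiple of \<open>x ^ (a + b - 1) d/dx\<close>.\<close>

lemma coefficient_relation:
  assumes "cocycle_identity \<alpha> \<beta> (homogenize d p)" and deg: "degree p \<le> d"
    and a: "2 \<le> a" and b: "2 \<le> b"
  shows "coeff p (a + b - 1) * (of_nat (a + b - 1 choose a) - of_nat (a + b - 1 choose (a - 1)))
    = coeff p a * (of_nat (d - a choose b) + \<beta> * of_nat (d - a choose (b - 1)))
    - coeff p b * (of_nat (d - b choose a) + \<beta> * of_nat (d - b choose (a - 1)))"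
proof -
  obtain q where q: "a = Suc q" "q \<noteq> 0" using a by (cases a) auto
  obtain r where r: "b = Suc r" "r \<noteq> 0" using b by (cases b) auto
  define X where "X = smult (coeff p a) ([:1, \<beta>:] * [:1, 1:] ^ (d - a))"
  define Y where "Y = (\<Sum>i\<le>d. monom (coeff p i *
    (of_nat (d - i choose a) + \<beta> * of_nat (d - i choose q))) i)"
  define Z where "Z = [:coeff p a + coeff p q, \<alpha> * coeff p a:]"
  define U where "U = (\<Sum>i\<le>d. monom (coeff p i * of_nat (i choose a)) (i - a))"
  define V where "V = (\<Sum>i\<le>d. monom (coeff p i * of_nat (i choose q)) (i - q))"
  have "poly (X - Y - Z) s = poly ([:0, 1:] * U - V) s" for s
    using coefficient_in_k[OF assms(1) deg, of s q] q
    unfolding X_def Y_def Z_def U_def V_def by (simp add: poly_sum poly_monom algebra_simps)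
  then have "X - Y - Z = [:0, 1:] * U - V"
    by (simp add: poly_eq_poly_eq_iff[symmetric] fun_eq_iff)
  then have "coeff (X - Y - Z) (Suc r) = coeff ([:0, 1:] * U - V) (Suc r)" by simp
  moreover have "coeff X (Suc r) = coeff p a *
      (of_nat (d - a choose Suc r) + \<beta> * of_nat (d - a choose r))"
    unfolding X_def coeff_smult coeff_pCons2_mult_Suc by (simp add: coeff_shift_power)
  moreover have "coeff Y (Suc r) = coeff p (Suc r) *
      (of_nat (d - Suc r choose a) + \<beta> * of_nat (d - Suc r choose q))"
    unfolding Y_def using deg by (auto simp: coeff_sum coeff_eq_0)
  moreover have "coeff Z (Suc r) = 0"
    unfolding Z_def using r by (cases r) auto
  moreover have "coeff U r = coeff p (a + r) * of_nat (a + r choose a)"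
  proof -
    have "coeff U r = (\<Sum>i\<le>d. if i = a + r then coeff p i * of_nat (i choose a) else 0)"
      unfolding U_def coeff_sum using r by (intro sum.cong refl) auto
    then show ?thesis using deg by (auto simp: coeff_eq_0)
  qed
  moreover have "coeff V (Suc r) = coeff p (a + r) * of_nat (a + r choose q)"
  proof -
    have "coeff V (Suc r) = (\<Sum>i\<le>d. if i = a + r then coeff p i * of_nat (i choose q) else 0)"
      unfolding V_def coeff_sum q by (intro sum.cong refl) auto
    then show ?thesis using deg by (auto simp: coeff_eq_0)
  qed
  ultimately have "coeff p (a + r) * of_nat (a + r choose a) - coeff p (a + r) * of_nat (a + r choose q)
     = coeff p a * (of_nat (d - a choose Suc r) + \<beta> * of_nat (d - a choose r)) -
      coeff p (Suc r) * (of_nat (d - Suc r choose a) + \<beta> * of_nat (d - Suc r choose q))"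
    by (simp only: coeff_diff coeff_pCons2_mult_Suc) simp
  moreover have "a + b - 1 = a + r" "a - 1 = q" "b - 1 = r" using q r by simp_all
  ultimately show ?thesis unfolding \<open>b = Suc r\<close> by (simp add: algebra_simps)
qed

text \<open>The fields \<open>x\<^sup>2 d/dx\<close> and \<open>x\<^sup>3 d/dx\<close> generate all fields that vanish to second order at the
origin: the relation with \<open>a = 2\<close> expresses each coefficient from the fourth on through its
predecessors.\<close>

lemma zero_if_coeff_23_zero:
  assumes "cocycle_identity \<alpha> \<beta> (homogenize d p)" and deg: "degree p \<le> d"
    and "coeff p 0 = 0" "coeff p 1 = 0" "coeff p 2 = 0" "coeff p 3 = 0"
  shows "p = 0"
proof -
  have "coeff p i = 0" for i
  proof (induction i rule: less_induct)
    case (less i)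
    show ?case
    proof (cases "i \<le> 3")
      case True
      then have "i = 0 \<or> i = 1 \<or> i = 2 \<or> i = 3" by auto
      then show ?thesis using assms by metis
    next
      case False
      then obtain b where b: "i = Suc b" "3 \<le> b" by (cases i) auto
      have "coeff p (Suc b) * (of_nat (Suc b choose 2) - of_nat (Suc b)) = 0"
        using coefficient_relation[OF assms(1) deg, of 2 b] less.IH[of b] b assms(5) by simp
      moreover have "Suc b choose 2 \<noteq> Suc b"
      proof
        assume "Suc b choose 2 = Suc b"
        then have "Suc b * b = Suc b * 2"
          using Suc_times_binomial_eq[of b 1] by (simp add: numeral_2_eq_2)
        then have "b = 2" by (metis mult_left_cancel nat.simps(3))
        then show False using b by simp
      qed
      ultimately show ?thesis
        using b by (metis mult_eq_0_iff of_nat_eq_iff right_minus_eq)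
    qed
  qed
  then show ?thesis by (simp add: poly_eq_iff)
qed

section \<open>Cocycles modulo coboundaries\<close>

lemma of_nat_choose_numeral:
  fixes m :: nat
  defines "x \<equiv> of_nat m :: complex"
  shows "of_nat (m choose 1) = x"
    "of_nat (m choose 2) = x * (x - 1) / 2"
    "of_nat (m choose 3) = x * (x - 1) * (x - 2) / 6"
    "of_nat (m choose 4) = x * (x - 1) * (x - 2) * (x - 3) / 24"
    "of_nat (m choose 5) = x * (x - 1) * (x - 2) * (x - 3) * (x - 4) / 120"
    "of_nat (m choose 6) = x * (x - 1) * (x - 2) * (x - 3) * (x - 4) * (x - 5) / 720"
  unfolding x_def
  by (simp_all add: binomial_gbinomial gbinomial_prod_rev eval_nat_numeral lessThan_Suc atLeast0_lessThan_Suc mult_ac fact_numeral)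

text \<open>Up to the factor \<open>n / 6\<close> this is the determinant of the second and third coefficients of
\<open>cob_poly \<alpha> \<beta> n\<close> and of \<open>p\<close>. For \<open>2 \<le> n = \<alpha> - \<beta>\<close> a homogeneous cocycle of
degree \<open>n + 1\<close> is determined by these two coefficients, so the determinant detects its cohomology class.\<close>

definition obstruction :: "complex \<Rightarrow> nat \<Rightarrow> complex poly \<Rightarrow> complex" where
  "obstruction \<beta> n p =
     3 * (of_nat n - 1 + 2 * \<beta>) * coeff p 3 - (of_nat n - 1) * (of_nat n - 2 + 3 * \<beta>) * coeff p 2"

text \<open>The coefficient of \<open>k ^ 6\<close> is obtained from both brackets of total index 7, those of
\<open>x\<^sup>2 d/dx\<close>, \<open>x ^ 5 d/dx\<close> and of \<open>x\<^sup>3 d/dx\<close>, \<open>x ^ 4 d/dx\<close>. Coboundaries satisfy the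
resulting linear condition on the second and third coefficients, so it is a multiple of the
determinant above. Nontrivial classes with \<open>5 \<le> n\<close> lie on the parabola
\<open>(n - 1 + 2 \<beta>)\<^sup>2 = 3 n + 1\<close>, which for \<open>n = 5\<close> gives \<open>\<beta> \<in> {0, -4}\<close> and for \<open>n = 6\<close> gives
\<open>2 \<beta> = -5 \<plusminus> sqrt 19\<close>.\<close>

lemma relation_degree_6:
  assumes "cocycle_identity \<alpha> \<beta> (homogenize (Suc n) p)" and deg: "degree p \<le> Suc n" and n: "5 \<le> n"
  shows "((of_nat n - 1 + 2 * \<beta>)\<^sup>2 - (3 * of_nat n + 1)) * obstruction \<beta> n p = 0"
proof -
  define N where "N = (of_nat n :: complex)"
  have sub: "of_nat (n - Suc 0) = N - 1" "of_nat (n - 2) = N - 2"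
    "of_nat (n - 3) = N - 3" "of_nat (n - 4) = N - 4"
    using n by (simp_all add: N_def of_nat_diff)
  note rel = coefficient_relation[OF assms(1) deg]
  have ch: "6 choose 3 = (20::nat)" "6 choose 2 = (15::nat)" "5 choose 2 = (10::nat)" "4 choose 2 = (6::nat)"
    by (simp_all add: eval_nat_numeral)
  have r23: "coeff p 4 = (coeff p 2 * ((N - 1) * (N - 2) * (N - 3) / 6 + \<beta> * ((N - 1) * (N - 2) / 2))
      - coeff p 3 * ((N - 2) * (N - 3) / 2 + \<beta> * (N - 2))) / 2"
    using rel[of 2 3] by (simp add: of_nat_choose_numeral sub ch field_simps)
  have r24: "coeff p 5 = (coeff p 2 * ((N - 1) * (N - 2) * (N - 3) * (N - 4) / 24 + \<beta> * ((N - 1) * (N - 2) * (N - 3) / 6))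
      - coeff p 4 * ((N - 3) * (N - 4) / 2 + \<beta> * (N - 3))) / 5"
    using rel[of 2 4] by (simp add: of_nat_choose_numeral sub ch field_simps)
  have r25: "coeff p 6 = (coeff p 2 * ((N - 1) * (N - 2) * (N - 3) * (N - 4) * (N - 5) / 120 + \<beta> * ((N - 1) * (N - 2) * (N - 3) * (N - 4) / 24))
      - coeff p 5 * ((N - 4) * (N - 5) / 2 + \<beta> * (N - 4))) / 9"
    using rel[of 2 5] by (simp add: of_nat_choose_numeral sub ch field_simps)
  have r34: "5 * coeff p 6 - (coeff p 3 * ((N - 2) * (N - 3) * (N - 4) * (N - 5) / 24 + \<beta> * ((N - 2) * (N - 3) * (N - 4) / 6))
      - coeff p 4 * ((N - 3) * (N - 4) * (N - 5) / 6 + \<beta> * ((N - 3) * (N - 4) / 2))) = 0"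
    using rel[of 3 4] by (simp add: of_nat_choose_numeral sub ch field_simps)
  \<comment> \<open>the discrepancy of the two expressions, after elimination of all later coefficients\<close>
  have "(N - 2) * (N - 3) * (N - 4) * ((N - 1 + 2 * \<beta>)\<^sup>2 - (3 * N + 1)) * obstruction \<beta> n p
     = - 432 * (5 * coeff p 6 - (coeff p 3 * ((N - 2) * (N - 3) * (N - 4) * (N - 5) / 24 + \<beta> * ((N - 2) * (N - 3) * (N - 4) / 6))
      - coeff p 4 * ((N - 3) * (N - 4) * (N - 5) / 6 + \<beta> * ((N - 3) * (N - 4) / 2))))"
    unfolding r25 r24 r23 obstruction_def N_def[symmetric] power2_eq_square
    by (simp add: field_simps)
  also have "\<dots> = 0" unfolding r34 by simp
  finally have "(N - 2) * (N - 3) * (N - 4) * ((N - 1 + 2 * \<beta>)\<^sup>2 - (3 * N + 1)) * obstruction \<beta> n p = 0" .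
  moreover have "N - 2 \<noteq> 0" "N - 3 \<noteq> 0" "N - 4 \<noteq> 0"
    using n unfolding N_def by (auto simp: right_minus_eq dest!: of_nat_eq_iff[THEN iffD1, of _ "numeral _", simplified])
  ultimately show ?thesis by (simp add: N_def)
qed
lemma coeff_cob_poly_23:
  fixes \<alpha> \<beta> :: complex and n :: nat
  shows "coeff (cob_poly \<alpha> \<beta> n) 2 = of_nat n * (of_nat n - 1 + 2 * \<beta>) / 2"
    and "coeff (cob_poly \<alpha> \<beta> n) 3 = of_nat n * (of_nat n - 1) * (of_nat n - 2 + 3 * \<beta>) / 6"
proof -
  show "coeff (cob_poly \<alpha> \<beta> n) 2 = of_nat n * (of_nat n - 1 + 2 * \<beta>) / 2"
    using coeff_cob_poly_Suc[of \<alpha> \<beta> n 1]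
    by (simp add: numeral_2_eq_2[symmetric] of_nat_choose_numeral) (simp add: field_simps)
  show "coeff (cob_poly \<alpha> \<beta> n) 3 = of_nat n * (of_nat n - 1) * (of_nat n - 2 + 3 * \<beta>) / 6"
    using coeff_cob_poly_Suc[of \<alpha> \<beta> n 2]
    by (simp add: numeral_3_eq_3[symmetric] of_nat_choose_numeral) (simp add: field_simps)
qed

lemma obstruction_cob_poly: "obstruction \<beta> n (cob_poly \<alpha> \<beta> n) = 0"
  unfolding obstruction_def coeff_cob_poly_23 by simp

lemma obstruction_diff: "obstruction \<beta> n (p - smult c q) = obstruction \<beta> n p - c * obstruction \<beta> n q"
  unfolding obstruction_def by (simp add: algebra_simps)

lemma cocycle_identity_homogenize_diff:
  assumes "cocycle_identity \<alpha> \<beta> (homogenize d p)" "cocycle_identity \<alpha> \<beta> (homogenize d q)"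
  shows "cocycle_identity \<alpha> \<beta> (homogenize d (p - smult c q))"
proof -
  have "homogenize d (p - smult c q) = (\<lambda>k m. homogenize d p k m - c * homogenize d q k m)"
    by (simp add: homogenize_diff fun_eq_iff)
  then show ?thesis using assms unfolding cocycle_identity_def by (simp add: defect_lin)
qed

lemma cocycle_identity_cob_poly: "cocycle_identity \<alpha> \<beta> (homogenize (Suc n) (cob_poly \<alpha> \<beta> n))"
proof -
  have "homogenize (Suc n) (cob_poly \<alpha> \<beta> n) = coboundary_of \<alpha> \<beta> (\<lambda>x. x ^ n)"
    by (simp add: homogenize_cob_poly fun_eq_iff)
  then show ?thesis using cocycle_identity_cob by simp
qed

lemma degree_diff_smult_le:
  "degree p \<le> d \<Longrightarrow> degree q \<le> d \<Longrightarrow> degree (p - smult c q) \<le> d" for p q :: "complex poly"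
  by (meson degree_diff_le degree_smult_le order_trans)

lemma cob_poly_23_nonzero:
  assumes "2 \<le> n"
  shows "coeff (cob_poly \<alpha> \<beta> n) 2 \<noteq> 0 \<or> coeff (cob_poly \<alpha> \<beta> n) 3 \<noteq> 0"
proof (rule ccontr)
  assume "\<not> ?thesis"
  moreover have "of_nat n \<noteq> (0::complex)" "of_nat n \<noteq> (1::complex)"
    using assms by simp_all
  ultimately have "of_nat n - 1 + 2 * \<beta> = 0" "of_nat n - 2 + 3 * \<beta> = 0"
    unfolding coeff_cob_poly_23 by auto
  moreover have "of_nat (Suc n) = 3 * (of_nat n - 1 + 2 * \<beta>) - 2 * (of_nat n - 2 + 3 * \<beta>)"
    by (simp add: algebra_simps)
  ultimately have "of_nat (Suc n) = (0::complex)" by simp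
  then show False by (simp only: of_nat_eq_0_iff)
qed

text \<open>If the determinant vanishes, subtracting a multiple of the coboundary kills the second and third
coefficients, hence everything.\<close>

lemma cob_poly_multiple:
  assumes coc: "cocycle_identity \<alpha> \<beta> (homogenize (Suc n) p)" and deg: "degree p \<le> Suc n" and p0: "coeff p 0 = 0"
    and n: "2 \<le> n" "\<alpha> - \<beta> = of_nat n" and W: "obstruction \<beta> n p = 0"
  obtains c where "p = smult c (cob_poly \<alpha> \<beta> n)"
proof -
  let ?C = "cob_poly \<alpha> \<beta> n"
  have "smult (coeff p 1) ?C = 0"
    using euler[OF coc deg p0] n by simp
  then have p1: "coeff p 1 = 0"
    using cob_poly_23_nonzero[OF n(1), of \<alpha> \<beta>] by auto
  have C1: "coeff ?C 1 = 0"
    using coeff_cob_poly_Suc[of \<alpha> \<beta> n 0] n(2) by (simp add: algebra_simps)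
  have W': "coeff ?C 2 * coeff p 3 = coeff ?C 3 * coeff p 2"
  proof -
    have "coeff ?C 2 * coeff p 3 - coeff ?C 3 * coeff p 2 = of_nat n / 6 * obstruction \<beta> n p"
      unfolding obstruction_def coeff_cob_poly_23 by (simp add: field_simps)
    then show ?thesis using W by simp
  qed
  obtain c where c: "coeff p 2 = c * coeff ?C 2" "coeff p 3 = c * coeff ?C 3"
  proof (cases "coeff ?C 2 = 0")
    case False
    then have "coeff p 3 = coeff p 2 / coeff ?C 2 * coeff ?C 3"
      using W' by (simp add: eq_divide_eq mult.commute)
    then show thesis using False by (intro that[of "coeff p 2 / coeff ?C 2"]) simp_all
  next
    case True
    then have C3: "coeff ?C 3 \<noteq> 0" using cob_poly_23_nonzero[OF n(1)] by blast
    then have "coeff p 2 = 0" using W' True by simp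
    with C3 True show thesis by (intro that[of "coeff p 3 / coeff ?C 3"]) simp_all
  qed
  have "p - smult c ?C = 0"
  proof (rule zero_if_coeff_23_zero[OF cocycle_identity_homogenize_diff[OF coc cocycle_identity_cob_poly]])
    show "degree (p - smult c ?C) \<le> Suc n"
      by (intro degree_diff_smult_le deg degree_cob_poly)
  qed (use c p0 p1 C1 coeff_cob_poly_0[of \<alpha> \<beta> n] in simp_all)
  then have "p = smult c ?C" by simp
  then show thesis by (rule that)
qed

text \<open>Normalizing the second coefficient to zero makes the recursion one-step, with factors linear in
\<open>x = n - 1 + 2 \<beta>\<close>.\<close>

lemma coeff_chain:
  assumes coc: "cocycle_identity \<alpha> \<beta> (homogenize (Suc n) p)" and deg: "degree p \<le> Suc n"
    and p2: "coeff p 2 = 0" and b: "3 \<le> b" "b \<le> n"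
  shows "coeff p (Suc b) = - (of_nat n + 1 - of_nat b) * (of_nat n - 1 + 2 * \<beta> + 1 - of_nat b)
    / ((of_nat b + 1) * (of_nat b - 2)) * coeff p b"
proof -
  define N where "N = (of_nat n :: complex)"
  define B where "B = (of_nat b :: complex)"
  have "of_nat (Suc n - b) = N + 1 - B"
    using b by (simp add: of_nat_diff N_def B_def)
  then have rel: "coeff p (Suc b) * ((B + 1) * B / 2 - (B + 1))
      = - coeff p b * ((N + 1 - B) * (N + 1 - B - 1) / 2 + \<beta> * (N + 1 - B))"
    using coefficient_relation[OF coc deg, of 2 b] b p2
    by (simp add: of_nat_choose_numeral B_def add.commute)
  have "coeff p (Suc b) * ((B + 1) * (B - 2)) = 2 * (coeff p (Suc b) * ((B + 1) * B / 2 - (B + 1)))"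
    by (simp add: field_simps)
  also have "\<dots> = - (N + 1 - B) * (N - 1 + 2 * \<beta> + 1 - B) * coeff p b"
    unfolding rel by (simp add: field_simps)
  finally have eq: "coeff p (Suc b) * ((B + 1) * (B - 2))
      = - (N + 1 - B) * (N - 1 + 2 * \<beta> + 1 - B) * coeff p b" .
  have "B + 1 \<noteq> 0" "B - 2 \<noteq> 0"
    using b of_nat_eq_iff[of b 2] of_nat_eq_iff[of "Suc b" 0] unfolding B_def
    by (auto simp del: of_nat_eq_iff simp add: add.commute)
  then have "(B + 1) * (B - 2) \<noteq> 0" by simp
  with eq show ?thesis
    unfolding N_def[symmetric] B_def[symmetric] by (simp add: eq_divide_eq)
qed

text \<open>The coefficient of \<open>k ^ 8\<close> again arises from several brackets. Comparing
\<open>x\<^sup>2 d/dx\<close>, \<open>x ^ 7 d/dx\<close> with \<open>x\<^sup>3 d/dx\<close>, \<open>x ^ 6 d/dx\<close> on the parabola, with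
a nonzero third coefficient, leaves \<open>x (x\<^sup>2 - 4) (x\<^sup>2 - 1) = 0\<close>, that is \<open>3 n + 1 \<in> {0, 4, 1}\<close>.\<close>

lemma relation_degree_8:
  assumes coc: "cocycle_identity \<alpha> \<beta> (homogenize (Suc n) p)" and deg: "degree p \<le> Suc n" and n: "7 \<le> n"
    and x: "x = of_nat n - 1 + 2 * \<beta>" "x\<^sup>2 = 3 * of_nat n + 1" and p2: "coeff p 2 = 0"
  shows "coeff p 3 = 0"
proof (rule ccontr)
  assume p3: "coeff p 3 \<noteq> 0"
  define N where "N = (of_nat n :: complex)"
  have sub: "of_nat (n - Suc 0) = N - 1" "of_nat (n - 2) = N - 2"
    "of_nat (n - 3) = N - 3" "of_nat (n - 4) = N - 4" "of_nat (n - 5) = N - 5" "of_nat (n - 6) = N - 6"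
    using n by (simp_all add: N_def of_nat_diff)
  have \<beta>: "\<beta> = (x - N + 1) / 2" using x(1) by (simp add: N_def)
  note rel = coefficient_relation[OF assms(1) deg]
  have ch: "8 choose 3 = (56::nat)" "8 choose 2 = (28::nat)" "7 choose 2 = (21::nat)"
    "6 choose 2 = (15::nat)" "5 choose 2 = (10::nat)" "4 choose 2 = (6::nat)"
    by (simp_all add: eval_nat_numeral)
  note chain = coeff_chain[OF coc deg p2, folded x(1) N_def]
  have step4: "coeff p 4 = - (N - 2) * (x - 2) / 4 * coeff p 3"
    using chain[of 3] n by simp
  have step5: "coeff p 5 = - (N - 3) * (x - 3) / 10 * coeff p 4"
    using chain[of 4] n by simp
  have step6: "coeff p 6 = - (N - 4) * (x - 4) / 18 * coeff p 5"
    using chain[of 5] n by simp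
  have step7: "coeff p 7 = - (N - 5) * (x - 5) / 28 * coeff p 6"
    using chain[of 6] n by simp
  have step8: "coeff p 8 = - (N - 6) * (x - 6) / 40 * coeff p 7"
    using chain[of 7] n by simp
  have "- n4 * x4 / 18 * (- n3 * x3 / 10 * (- n2 * x2 / 4 * c))
      = - (n2 * n3 * n4 * (x2 * x3 * x4)) / 720 * c" for n2 n3 n4 x2 x3 x4 c :: complex
    by (simp add: field_simps)
  then have r6: "coeff p 6 = - ((N - 2) * (N - 3) * (N - 4) * ((x - 2) * (x - 3) * (x - 4))) / 720 * coeff p 3"
    unfolding step6 step5 step4 .
  have "- n6 * x6 / 40 * (- n5 * x5 / 28 * (- (n2 * n3 * n4 * (x2 * x3 * x4)) / 720 * c))
      = - (n2 * n3 * n4 * n5 * n6 * (x2 * x3 * x4 * x5 * x6)) / 806400 * c"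
    for n2 n3 n4 n5 n6 x2 x3 x4 x5 x6 c :: complex
    by (simp add: field_simps)
  then have r8: "coeff p 8 = - ((N - 2) * (N - 3) * (N - 4) * (N - 5) * (N - 6)
      * ((x - 2) * (x - 3) * (x - 4) * (x - 5) * (x - 6))) / 806400 * coeff p 3"
    unfolding step8 step7 r6 .
  have factor: "28 * (- (n2 * n3 * n4 * n5 * n6 * (x2 * x3 * x4 * x5 * x6)) / 806400 * c)
     - (c * (n2 * n3 * n4 * n5 * n6 * A / 720)
       - - (n2 * n3 * n4 * (x2 * x3 * x4)) / 720 * c * (n5 * n6 * B / 12))
     = c * (n2 * n3 * n4 * n5 * n6) * (- (x2 * x3 * x4 * x5 * x6) / 28800 - A / 720 - x2 * x3 * x4 * B / 8640)"
    for n2 n3 n4 n5 n6 x2 x3 x4 x5 x6 c A B :: complex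
    by (simp add: field_simps)
  have "28 * coeff p 8
     = coeff p 3 * ((N - 2) * (N - 3) * (N - 4) * (N - 5) * (N - 6) * (N - 7) / 720
         + \<beta> * ((N - 2) * (N - 3) * (N - 4) * (N - 5) * (N - 6) / 120))
       - coeff p 6 * ((N - 5) * (N - 6) * (N - 7) / 6 + \<beta> * ((N - 5) * (N - 6) / 2))"
    using rel[of 3 6] by (simp add: of_nat_choose_numeral sub ch field_simps)
  moreover have "(N - 2) * (N - 3) * (N - 4) * (N - 5) * (N - 6) * (N - 7) / 720
         + \<beta> * ((N - 2) * (N - 3) * (N - 4) * (N - 5) * (N - 6) / 120)
      = (N - 2) * (N - 3) * (N - 4) * (N - 5) * (N - 6) * (3 * x - 2 * N - 4) / 720"
    "(N - 5) * (N - 6) * (N - 7) / 6 + \<beta> * ((N - 5) * (N - 6) / 2)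
      = (N - 5) * (N - 6) * (3 * x - N - 11) / 12"
    unfolding \<beta> by (simp_all add: field_simps)
  ultimately have "28 * coeff p 8
     - (coeff p 3 * ((N - 2) * (N - 3) * (N - 4) * (N - 5) * (N - 6) * (3 * x - 2 * N - 4) / 720)
       - coeff p 6 * ((N - 5) * (N - 6) * (3 * x - N - 11) / 12)) = 0"
    by (simp only: diff_self)
  moreover have "28 * coeff p 8
     - (coeff p 3 * ((N - 2) * (N - 3) * (N - 4) * (N - 5) * (N - 6) * (3 * x - 2 * N - 4) / 720)
       - coeff p 6 * ((N - 5) * (N - 6) * (3 * x - N - 11) / 12))
     = coeff p 3 * ((N - 2) * (N - 3) * (N - 4) * (N - 5) * (N - 6)) *
      (- ((x - 2) * (x - 3) * (x - 4) * (x - 5) * (x - 6)) / 28800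
       - (3 * x - 2 * N - 4) / 720 - (x - 2) * (x - 3) * (x - 4) * (3 * x - N - 11) / 8640)"
    unfolding r8 r6 by (rule factor)
  moreover have nz: "N - of_nat j \<noteq> 0" if "j < 7" for j
    using n that unfolding N_def by simp
  have "coeff p 3 * ((N - 2) * (N - 3) * (N - 4) * (N - 5) * (N - 6)) \<noteq> 0"
    using p3 nz[of 2] nz[of 3] nz[of 4] nz[of 5] nz[of 6] by simp
  ultimately have vanish: "- ((x - 2) * (x - 3) * (x - 4) * (x - 5) * (x - 6)) / 28800
       - (3 * x - 2 * N - 4) / 720 - (x - 2) * (x - 3) * (x - 4) * (3 * x - N - 11) / 8640 = 0"
    by (simp only: mult_eq_0_iff) blast
  have N: "N = (x\<^sup>2 - 1) / 3" using x(2) by (simp add: N_def)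
  have "- ((x - 2) * (x - 3) * (x - 4) * (x - 5) * (x - 6)) / 28800
       - (3 * x - 2 * N - 4) / 720 - (x - 2) * (x - 3) * (x - 4) * (3 * x - N - 11) / 8640
      = x * (x\<^sup>2 - 4) * (x\<^sup>2 - 1) / 259200"
    unfolding N by (simp add: field_simps power2_eq_square)
  then have "x * (x\<^sup>2 - 4) * (x\<^sup>2 - 1) / 259200 = 0"
    unfolding vanish by (rule sym)
  then have "x\<^sup>2 = 0 \<or> x\<^sup>2 = 4 \<or> x\<^sup>2 = 1" by auto
  then have "of_nat (3 * n + 1) = (of_nat 0 :: complex) \<or> of_nat (3 * n + 1) = (of_nat 4 :: complex)
      \<or> of_nat (3 * n + 1) = (of_nat 1 :: complex)"
    unfolding x(2) by (simp add: add.commute)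
  then have "3 * n + 1 = 0 \<or> 3 * n + 1 = 4 \<or> 3 * n + 1 = 1"
    unfolding of_nat_eq_iff .
  then show False using n by simp
qed


text \<open>For \<open>7 \<le> n\<close> no class survives both relations. On the parabola \<open>x\<close> is nonzero, hence so is the
second coefficient of the coboundary, and the second coefficient of \<open>p\<close> can be normalized to zero.\<close>

lemma obstruction_eq_0:
  assumes coc: "cocycle_identity \<alpha> \<beta> (homogenize (Suc n) p)" and deg: "degree p \<le> Suc n" and n: "7 \<le> n"
  shows "obstruction \<beta> n p = 0"
proof (rule ccontr)
  assume W: "obstruction \<beta> n p \<noteq> 0"
  define x where "x = of_nat n - 1 + 2 * \<beta>"
  let ?C = "cob_poly \<alpha> \<beta> n"
  have x2: "x\<^sup>2 = 3 * of_nat n + 1"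
  proof -
    have "(x\<^sup>2 - (3 * of_nat n + 1)) * obstruction \<beta> n p = 0"
      unfolding x_def by (rule relation_degree_6[OF coc deg]) (use n in simp)
    then show ?thesis using W by simp
  qed
  have "x \<noteq> 0"
  proof
    assume "x = 0"
    then have "of_nat (3 * n + 1) = (0 :: complex)" using x2 by (simp add: add.commute)
    then show False unfolding of_nat_eq_0_iff by simp
  qed
  then have C2: "coeff ?C 2 \<noteq> 0"
    using n unfolding coeff_cob_poly_23 x_def by simp
  define q where "q = p - smult (coeff p 2 / coeff ?C 2) ?C"
  have q2: "coeff q 2 = 0" using C2 by (simp add: q_def)
  have "coeff q 3 = 0"
  proof (rule relation_degree_8[OF _ _ n x_def x2 q2])
    show "cocycle_identity \<alpha> \<beta> (homogenize (Suc n) q)"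
      unfolding q_def by (intro cocycle_identity_homogenize_diff coc cocycle_identity_cob_poly)
    show "degree q \<le> Suc n"
      unfolding q_def by (intro degree_diff_smult_le deg degree_cob_poly)
  qed
  then have "obstruction \<beta> n q = 0" using q2 by (simp add: obstruction_def)
  moreover have "obstruction \<beta> n q = obstruction \<beta> n p"
    by (simp add: q_def obstruction_diff obstruction_cob_poly)
  ultimately show False using W by simp
qed

section \<open>The listed cocycles\<close>

text \<open>The value of \<open>\<alpha> - \<beta>\<close> at which an entry lives; its polynomial has degree one more.\<close>

primrec listed_index :: "entry \<Rightarrow> nat" where
  "listed_index Entry_i = 0"
| "listed_index Entry_ii = 1"
| "listed_index Entry_iii = 1"
| "listed_index Entry_iv = 2"
| "listed_index Entry_v = 3"
| "listed_index Entry_vi = 4"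
| "listed_index Entry_vii = 5"
| "listed_index Entry_viii = 5"
| "listed_index Entry_ix = 6"
| "listed_index Entry_x = 6"

primrec listed_coeffs :: "entry \<Rightarrow> complex \<Rightarrow> complex poly" where
  "listed_coeffs Entry_i \<alpha> = [:0, 1:]"
| "listed_coeffs Entry_ii \<alpha> = [:0, 1:]"
| "listed_coeffs Entry_iii \<alpha> = [:0, 0, 1:]"
| "listed_coeffs Entry_iv \<alpha> = [:0, 0, 2, 1:]"
| "listed_coeffs Entry_v \<alpha> = [:0, 0, 1, 1:]"
| "listed_coeffs Entry_vi \<alpha> = [:0, 0, -4, -6, 1, 4 - \<alpha>:]"
| "listed_coeffs Entry_vii \<alpha> = [:0, 0, -5, -10, 5, 22, 12:]"
| "listed_coeffs Entry_viii \<alpha> = [:0, 0, 5, 10, -5, 2:]"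
| "listed_coeffs Entry_ix \<alpha> = [:0, 0, 2, 5, -5, - ((25 - 7 * sqrt19) / 2),
     - ((31 - 7 * sqrt19) / 2), - ((22 - 5 * sqrt19) / 4):]"
| "listed_coeffs Entry_x \<alpha> = [:0, 0, 2, 5, -5, - ((25 + 7 * sqrt19) / 2),
     - ((31 + 7 * sqrt19) / 2), - ((22 + 5 * sqrt19) / 4):]"

lemma listed_poly_homogenize: "listed_poly e \<alpha> = homogenize (Suc (listed_index e)) (listed_coeffs e \<alpha>)"
  by (cases e) (simp_all add: homogenize_def fun_eq_iff eval_nat_numeral)

lemma degree_listed_coeffs: "degree (listed_coeffs e \<alpha>) \<le> Suc (listed_index e)"
  by (cases e) (simp_all add: degree_pCons_eq_if)

lemma coeff_listed_coeffs_0: "coeff (listed_coeffs e \<alpha>) 0 = 0"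
  by (cases e) simp_all

lemma attached_index: "attached e \<alpha> \<beta> \<Longrightarrow> \<alpha> - \<beta> = of_nat (listed_index e)"
proof -
  have half: "(7 + r) / 2 - (-5 + r) / 2 = 6" "(7 - r) / 2 - (-5 - r) / 2 = 6" for r :: complex
    by (simp_all add: field_simps)
  assume "attached e \<alpha> \<beta>"
  then show ?thesis
    by (cases e) (auto simp only: attached.simps listed_index.simps half, simp_all)
qed

lemma sqrt19_square: "sqrt19 * sqrt19 = 19"
  by (metis abs_numeral of_real_mult of_real_numeral real_sqrt_mult_self)

lemma obstruction_listed:
  assumes "attached e \<alpha> \<beta>" "2 \<le> listed_index e"
  shows "obstruction \<beta> (listed_index e) (listed_coeffs e \<alpha>) \<noteq> 0"
proof (cases e)
  case Entry_vi
  then have "\<alpha> = \<beta> + 4" using assms(1) by (simp add: algebra_simps)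
  with Entry_vi show ?thesis by (simp add: obstruction_def eval_nat_numeral algebra_simps)
next
  case Entry_ix
  then have \<beta>: "\<beta> = (-5 + sqrt19) / 2" using assms(1) by (simp only: attached.simps)
  have "obstruction \<beta> 6 (listed_coeffs Entry_ix \<alpha>) = 35"
    unfolding \<beta> by (simp add: obstruction_def eval_nat_numeral field_simps)
  with Entry_ix show ?thesis by simp
next
  case Entry_x
  then have \<beta>: "\<beta> = (-5 - sqrt19) / 2" using assms(1) by (simp only: attached.simps)
  have "obstruction \<beta> 6 (listed_coeffs Entry_x \<alpha>) = 35"
    unfolding \<beta> by (simp add: obstruction_def eval_nat_numeral field_simps)
  with Entry_x show ?thesis by simp
qed (use assms in \<open>auto simp: obstruction_def eval_nat_numeral algebra_simps\<close>)

text \<open>Both entries with irrational parameters are instances of one identity, in which only \<open>r\<^sup>2 = 19\<close>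
matters.\<close>

lemma cocycle_identity_ix:
  assumes r: "r * r = (19::complex)"
  shows "cocycle_identity ((7 + r) / 2) ((-5 + r) / 2) (\<lambda>k m.
     - ((22 - 5 * r) / 4) * k^7 - (31 - 7 * r) / 2 * k^6 * m
     - (25 - 7 * r) / 2 * k^5 * m^2 - 5 * k^4 * m^3 + 5 * k^3 * m^4 + 2 * k^2 * m^5)"
proof -
  have "r * r - 19 = 0" using r by simp
  then show ?thesis
  unfolding cocycle_identity_def defect_def by (intro allI) algebra
qed

lemma cocycle_identity_listed:
  assumes "attached e \<alpha> \<beta>"
  shows "cocycle_identity \<alpha> \<beta> (listed_poly e \<alpha>)"
proof (cases e)
  case Entry_i
  then have "\<beta> = \<alpha>" using assms by simp
  with Entry_i show ?thesis
    by (simp add: cocycle_identity_def defect_def algebra_simps)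
next
  case Entry_ii
  with assms show ?thesis by (simp add: cocycle_identity_def defect_def algebra_simps)
next
  case Entry_iii
  with assms show ?thesis by (simp add: cocycle_identity_def defect_def algebra_simps power2_eq_square)
next
  case Entry_iv
  then have \<alpha>: "\<alpha> = \<beta> + 2" using assms by (simp add: algebra_simps)
  show ?thesis unfolding Entry_iv cocycle_identity_def defect_def listed_poly.simps \<alpha>
    by (intro allI) algebra
next
  case Entry_v
  then have \<alpha>: "\<alpha> = \<beta> + 3" using assms by (simp add: algebra_simps)
  show ?thesis unfolding Entry_v cocycle_identity_def defect_def listed_poly.simps \<alpha>
    by (intro allI) algebra
next
  case Entry_vi
  then have \<alpha>: "\<alpha> = \<beta> + 4" using assms by (simp add: algebra_simps)
  show ?thesis unfolding Entry_vi cocycle_identity_def defect_def listed_poly.simps \<alpha>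
    by (intro allI) algebra
next
  case Entry_vii
  then have \<alpha>: "\<alpha> = 1" "\<beta> = -4" using assms by simp_all
  show ?thesis unfolding Entry_vii cocycle_identity_def defect_def listed_poly.simps \<alpha>
    by (intro allI) algebra
next
  case Entry_viii
  then have \<alpha>: "\<alpha> = 5" "\<beta> = 0" using assms by simp_all
  show ?thesis unfolding Entry_viii cocycle_identity_def defect_def listed_poly.simps \<alpha>
    by (intro allI) algebra
next
  case Entry_ix
  then have \<alpha>: "\<alpha> = (7 + sqrt19) / 2" "\<beta> = (-5 + sqrt19) / 2"
    using assms by (simp_all only: attached.simps)
  have "listed_poly e \<alpha> = (\<lambda>k m.
     - ((22 - 5 * sqrt19) / 4) * k^7 - (31 - 7 * sqrt19) / 2 * k^6 * m
     - (25 - 7 * sqrt19) / 2 * k^5 * m^2 - 5 * k^4 * m^3 + 5 * k^3 * m^4 + 2 * k^2 * m^5)"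
    unfolding Entry_ix fun_eq_iff by simp
  then show ?thesis
    using cocycle_identity_ix[OF sqrt19_square] unfolding \<alpha> by simp
next
  case Entry_x
  then have \<alpha>: "\<alpha> = (7 + - sqrt19) / 2" "\<beta> = (-5 + - sqrt19) / 2"
    using assms by (simp_all only: attached.simps diff_conv_add_uminus)
  have sq: "- sqrt19 * - sqrt19 = 19" using sqrt19_square by simp
  have "listed_poly e \<alpha> = (\<lambda>k m.
     - ((22 - 5 * - sqrt19) / 4) * k^7 - (31 - 7 * - sqrt19) / 2 * k^6 * m
     - (25 - 7 * - sqrt19) / 2 * k^5 * m^2 - 5 * k^4 * m^3 + 5 * k^3 * m^4 + 2 * k^2 * m^5)"
    unfolding Entry_x fun_eq_iff by simp
  then show ?thesis
    using cocycle_identity_ix[OF sq] unfolding \<alpha> by metis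
qed

lemma cocycle_listed_sum:
  "cocycle \<alpha> \<beta> \<gamma> (\<lambda>k m. \<Sum>e | attached e \<alpha> \<beta>. c e * listed e \<alpha> k m)"
proof -
  have "cocycle \<alpha> \<beta> \<gamma> (\<lambda>k m. (\<lambda>k m. \<Sum>e | attached e \<alpha> \<beta>. c e * listed_poly e \<alpha> k m) (of_int k) m)"
  proof (rule cocycle_identity_imp_cocycle)
    show "cocycle_identity \<alpha> \<beta> (\<lambda>k m. \<Sum>e | attached e \<alpha> \<beta>. c e * listed_poly e \<alpha> k m)"
      unfolding cocycle_identity_def defect_sum
      using cocycle_identity_listed by (auto simp: defect_scale cocycle_identity_def intro!: sum.neutral)
    have "listed_poly e \<alpha> 0 m = 0" for e m
      by (cases e) simp_all
    then show "(\<Sum>e | attached e \<alpha> \<beta>. c e * listed_poly e \<alpha> 0 m) = 0" for m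
      by simp
  qed
  then show ?thesis by (simp add: listed_def)
qed

lemma cocycle_listed:
  assumes "attached e \<alpha> \<beta>"
  shows "cocycle \<alpha> \<beta> \<gamma> (listed e \<alpha>)"
proof -
  have "listed_poly e \<alpha> 0 m = 0" for m
    by (cases e) simp_all
  then show ?thesis
    unfolding listed_def using cocycle_identity_imp_cocycle[OF cocycle_identity_listed[OF assms]] by blast
qed

section \<open>Classification of homogeneous cocycles\<close>

definition reducible :: "complex \<Rightarrow> complex \<Rightarrow> (complex \<Rightarrow> complex \<Rightarrow> complex) \<Rightarrow> bool" where
  "reducible \<alpha> \<beta> f \<longleftrightarrow> (\<exists>g c. \<forall>k m.
     f k m = coboundary_of \<alpha> \<beta> g k m + (\<Sum>e | attached e \<alpha> \<beta>. c e * listed_poly e \<alpha> k m))"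

lemma reducible_cob: "reducible \<alpha> \<beta> (coboundary_of \<alpha> \<beta> g)"
  unfolding reducible_def by (intro exI[of _ g] exI[of _ "\<lambda>_. 0"]) simp

lemma reducible_listed:
  assumes "attached e \<alpha> \<beta>"
  shows "reducible \<alpha> \<beta> (\<lambda>k m. c * listed_poly e \<alpha> k m)"
  unfolding reducible_def
proof (intro exI allI)
  fix k m
  have "(\<Sum>e' | attached e' \<alpha> \<beta>. (if e' = e then c else 0) * listed_poly e' \<alpha> k m)
      = (\<Sum>e' | attached e' \<alpha> \<beta>. if e' = e then c * listed_poly e' \<alpha> k m else 0)"
    by (intro sum.cong) auto
  also have "\<dots> = c * listed_poly e \<alpha> k m"
    using assms by simp
  finally show "c * listed_poly e \<alpha> k m = coboundary_of \<alpha> \<beta> (\<lambda>_. 0) k m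
      + (\<Sum>e' | attached e' \<alpha> \<beta>. (if e' = e then c else 0) * listed_poly e' \<alpha> k m)"
    by (simp add: coboundary_of_def)
qed

lemma reducible_add:
  assumes "reducible \<alpha> \<beta> f" "reducible \<alpha> \<beta> h"
  shows "reducible \<alpha> \<beta> (\<lambda>k m. f k m + h k m)"
proof -
  obtain g c g' c' where
    "\<And>k m. f k m = coboundary_of \<alpha> \<beta> g k m + (\<Sum>e | attached e \<alpha> \<beta>. c e * listed_poly e \<alpha> k m)"
    "\<And>k m. h k m = coboundary_of \<alpha> \<beta> g' k m + (\<Sum>e | attached e \<alpha> \<beta>. c' e * listed_poly e \<alpha> k m)"
    using assms unfolding reducible_def by blast
  then show ?thesis
    unfolding reducible_def
    by (intro exI[of _ "\<lambda>m. g m + g' m"] exI[of _ "\<lambda>e. c e + c' e"])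
      (simp add: coboundary_of_def sum.distrib distrib_left distrib_right)
qed

lemma reducible_sum:
  assumes "\<And>i. i \<in> A \<Longrightarrow> reducible \<alpha> \<beta> (f i)"
  shows "reducible \<alpha> \<beta> (\<lambda>k m. \<Sum>i\<in>A. f i k m)"
proof -
  have "reducible \<alpha> \<beta> (\<lambda>k m. 0)"
    using reducible_cob[of \<alpha> \<beta> "\<lambda>_. 0"] by (simp add: coboundary_of_def[abs_def])
  then show ?thesis
    using assms by (induction A rule: infinite_finite_induct) (auto intro: reducible_add)
qed

lemma homogenize_smult: "homogenize d (smult c p) k m = c * homogenize d p k m"
  unfolding homogenize_def by (simp add: sum_distrib_left mult_ac)

lemma reducible_cob_poly: "reducible \<alpha> \<beta> (homogenize (Suc n) (smult c (cob_poly \<alpha> \<beta> n)))"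
proof -
  have "homogenize (Suc n) (smult c (cob_poly \<alpha> \<beta> n)) = coboundary_of \<alpha> \<beta> (\<lambda>x. c * x ^ n)"
    by (simp add: fun_eq_iff homogenize_smult homogenize_cob_poly coboundary_of_def algebra_simps)
  then show ?thesis by (simp add: reducible_cob)
qed

text \<open>Outside degree \<open>n + 1\<close> with \<open>n = \<alpha> - \<beta>\<close>, Euler's identity applies. In that degree the cohomology is
at most one-dimensional for \<open>2 \<le> n\<close>, since one determinant controls it: either a listed cocycle with nonzero
determinant is available to cancel that of \<open>p\<close>, or the relations force it to vanish.\<close>

lemma homogenize_reducible:
  assumes coc: "cocycle_identity \<alpha> \<beta> (homogenize d p)" and deg: "degree p \<le> d" and p0: "coeff p 0 = 0"
  shows "reducible \<alpha> \<beta> (homogenize d p)"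
proof (cases d)
  case 0
  then have "p = 0" using deg p0 by (metis le_zero_eq leading_coeff_0_iff)
  then have "homogenize d p = (\<lambda>k m. \<Sum>i\<in>{}. 0)"
    by (simp add: homogenize_def fun_eq_iff)
  then show ?thesis using reducible_sum[of "{}"] by simp
next
  case (Suc n)
  note coc = coc[unfolded Suc] and deg = deg[unfolded Suc]
  let ?C = "cob_poly \<alpha> \<beta> n"
  note euler = euler[OF coc deg p0]
  have "reducible \<alpha> \<beta> (homogenize (Suc n) p)"
  proof (cases "\<alpha> - \<beta> = of_nat n")
    case False
    define c where "c = of_nat n - (\<alpha> - \<beta>)"
    have "c \<noteq> 0" using False by (simp add: c_def)
    then have "p = smult (coeff p 1 / c) ?C"
      using arg_cong[OF euler, of "smult (1 / c)"] by (simp add: c_def[symmetric])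
    then show ?thesis using reducible_cob_poly by metis
  next
    case eq: True
    have C1: "smult (coeff p 1) ?C = 0" using euler eq by simp
    consider "n = 0" | "n = 1" | "2 \<le> n" by linarith
    then show ?thesis
    proof cases
      case 1
      then have "homogenize (Suc n) p = (\<lambda>k m. coeff p 1 * listed_poly Entry_i \<alpha> k m)"
        by (simp add: homogenize_def fun_eq_iff p0)
      then show ?thesis using eq 1 reducible_listed[of Entry_i \<alpha> \<beta>] by simp
    next
      case 2
      have \<alpha>: "\<alpha> = \<beta> + 1" using eq 2 by (simp add: algebra_simps)
      have homogenize: "homogenize (Suc n) p k m = coeff p 1 * (k * m) + coeff p 2 * k\<^sup>2" for k m
        unfolding 2 homogenize_def by (simp add: p0 numeral_2_eq_2)
      show ?thesis
      proof (cases "\<beta> = 0")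
        case True
        have "homogenize (Suc n) p = (\<lambda>k m. coeff p 1 * listed_poly Entry_ii \<alpha> k m
            + coeff p 2 * listed_poly Entry_iii \<alpha> k m)"
          by (simp add: fun_eq_iff homogenize)
        then show ?thesis
          using True \<alpha> by (simp only:) (intro reducible_add reducible_listed, simp_all)
      next
        case False
        have "coeff ?C 2 = \<beta>" unfolding coeff_cob_poly_23 2 by simp
        then have "coeff p 1 = 0" using C1 False by auto
        then have "homogenize (Suc n) p = coboundary_of \<alpha> \<beta> (\<lambda>x. coeff p 2 / \<beta> * x)"
          using False by (simp add: fun_eq_iff homogenize coboundary_of_def \<alpha> field_simps power2_eq_square)
        then show ?thesis by (simp add: reducible_cob)
      qed
    next
      case n: 3
      have from_obstruction: ?thesis if W0: "obstruction \<beta> n p = 0"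
      proof -
        obtain c where "p = smult c ?C"
          using cob_poly_multiple[OF coc deg p0 n eq W0] .
        then show ?thesis using reducible_cob_poly by simp
      qed
      show ?thesis
      proof (cases "\<exists>e. attached e \<alpha> \<beta> \<and> listed_index e = n")
        case True
        then obtain e where e: "attached e \<alpha> \<beta>" "listed_index e = n" by blast
        define L where "L = listed_coeffs e \<alpha>"
        have L: "listed_poly e \<alpha> = homogenize (Suc n) L" "degree L \<le> Suc n" "coeff L 0 = 0"
          using listed_poly_homogenize[of e \<alpha>] degree_listed_coeffs[of e \<alpha>] coeff_listed_coeffs_0
          unfolding L_def e(2) by simp_all
        have WL: "obstruction \<beta> n L \<noteq> 0"
          using obstruction_listed[OF e(1)] n unfolding L_def e(2) by simp
        define c where "c = obstruction \<beta> n p / obstruction \<beta> n L"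
        have "obstruction \<beta> n (p - smult c L) = 0"
          using WL by (simp add: obstruction_diff c_def)
        moreover have "cocycle_identity \<alpha> \<beta> (homogenize (Suc n) (p - smult c L))"
          using cocycle_identity_homogenize_diff[OF coc] cocycle_identity_listed[OF e(1)] L(1) by simp
        moreover have "degree (p - smult c L) \<le> Suc n"
          by (intro degree_diff_smult_le deg L)
        moreover have "coeff (p - smult c L) 0 = 0" using p0 L by simp
        ultimately obtain c' where c': "p - smult c L = smult c' ?C"
          using cob_poly_multiple n eq by blast
        have "homogenize (Suc n) p = (\<lambda>k m. homogenize (Suc n) (smult c' ?C) k m + c * listed_poly e \<alpha> k m)"
          unfolding c'[symmetric] L(1) homogenize_diff by simp
        then show ?thesis
          by (simp only:) (intro reducible_add reducible_cob_poly reducible_listed e)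
      next
        case False
        have "obstruction \<beta> n p = 0"
        proof (cases "7 \<le> n")
          case True
          then show ?thesis using obstruction_eq_0[OF coc deg] by simp
        next
          case lt: False
          have \<alpha>: "\<alpha> = \<beta> + of_nat n" using eq by (simp add: algebra_simps)
          have not: "\<not> attached e \<alpha> \<beta>" if "listed_index e = n" for e
            using False that by blast
          have n56: "n = 5 \<or> n = 6"
          proof (rule ccontr)
            assume "\<not> ?thesis"
            then have "n = 2 \<or> n = 3 \<or> n = 4" using n lt by linarith
            then show False
              using not[of Entry_iv] not[of Entry_v] not[of Entry_vi] \<alpha> by auto
          qed
          have rel: "((of_nat n - 1 + 2 * \<beta>)\<^sup>2 - (3 * of_nat n + 1)) * obstruction \<beta> n p = 0"
            by (rule relation_degree_6[OF coc deg]) (use n56 in auto)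
          from n56 show ?thesis
          proof
            assume n5: "n = 5"
            have "\<beta> \<noteq> 0" "\<beta> \<noteq> -4"
              using not[of Entry_vii] not[of Entry_viii] \<alpha> n5 by auto
            moreover have "(of_nat n - 1 + 2 * \<beta>)\<^sup>2 - (3 * of_nat n + 1) = 4 * \<beta> * (\<beta> + 4)"
              unfolding n5 by (simp add: algebra_simps power2_eq_square)
            ultimately show ?thesis using rel by (auto simp: add_eq_0_iff2)
          next
            assume n6: "n = 6"
            have "\<beta> \<noteq> (-5 + sqrt19) / 2" "\<beta> \<noteq> (-5 - sqrt19) / 2"
              using not[of Entry_ix] not[of Entry_x] n6 unfolding \<alpha> n6
              by (auto simp: field_simps)
            moreover have "\<beta> = (-5 + r) / 2" if "2 * \<beta> + 5 - r = 0" for r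
            proof -
              have "\<beta> = ((2 * \<beta> + 5 - r) - 5 + r) / 2" by simp
              also have "\<dots> = (-5 + r) / 2" unfolding that by simp
              finally show ?thesis .
            qed
            from this[of sqrt19] this[of "- sqrt19"]
            have "2 * \<beta> + 5 - sqrt19 = 0 \<Longrightarrow> \<beta> = (-5 + sqrt19) / 2"
              "2 * \<beta> + 5 + sqrt19 = 0 \<Longrightarrow> \<beta> = (-5 - sqrt19) / 2"
              by simp_all
            ultimately have "2 * \<beta> + 5 - sqrt19 \<noteq> 0" "2 * \<beta> + 5 + sqrt19 \<noteq> 0"
              by metis+
            moreover have "(of_nat n - 1 + 2 * \<beta>)\<^sup>2 - (3 * of_nat n + 1)
                = (2 * \<beta> + 5 - sqrt19) * (2 * \<beta> + 5 + sqrt19)"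
              unfolding n6 by (simp add: algebra_simps power2_eq_square sqrt19_square)
            ultimately show ?thesis using rel by simp
          qed
        qed
        then show ?thesis by (rule from_obstruction)
      qed
    qed
  qed
  then show ?thesis unfolding Suc .
qed

section \<open>Classification of polynomial cocycles\<close>

lemma polynomial_cocycle_reducible:
  assumes "polynomial_cocycle \<alpha> \<beta> \<gamma> \<tau>"
  obtains g c where "\<And>k m. m \<in> weights \<gamma> \<Longrightarrow>
    \<tau> k m = coboundary_of \<alpha> \<beta> g (of_int k) m + (\<Sum>e | attached e \<alpha> \<beta>. c e * listed e \<alpha> k m)"
proof -
  obtain N a where coc: "cocycle \<alpha> \<beta> \<gamma> \<tau>" and
    \<tau>: "\<And>k m. m \<in> weights \<gamma> \<Longrightarrow> \<tau> k m = (\<Sum>i\<le>N. \<Sum>j\<le>N. a i j * of_int k ^ i * m ^ j)"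
    using assms unfolding polynomial_cocycle_def by blast
  obtain p where deg: "\<And>d. degree (p d) \<le> d" and
    p: "\<And>k m. (\<Sum>i\<le>N. \<Sum>j\<le>N. a i j * k ^ i * m ^ j) = (\<Sum>d\<le>2*N. homogenize d (p d) k m)"
    using homogenize_decomp[of a N] by blast
  define T where "T k m = (\<Sum>d\<le>2*N. homogenize d (p d) k m)" for k m
  have T: "\<tau> k m = T (of_int k) m" if "m \<in> weights \<gamma>" for k m
    using \<tau>[OF that] p unfolding T_def by simp
  have "cocycle_identity \<alpha> \<beta> T"
    unfolding cocycle_identity_def
  proof (intro allI)
    fix k s m
    show "defect \<alpha> \<beta> T k s m = 0"
    proof (rule zero_by_density[where F = "defect \<alpha> \<beta> T" and \<gamma> = \<gamma>])
      fix k s :: int and m assume m: "m \<in> weights \<gamma>"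
      have "(of_int s - of_int k) * \<tau> (k + s) m =
            (m + \<beta> * of_int s) * \<tau> k (m + of_int s)
          - (m + \<beta> * of_int k) * \<tau> s (m + of_int k)
          + (m + of_int s + \<alpha> * of_int k) * \<tau> s m
          - (m + of_int k + \<alpha> * of_int s) * \<tau> k m"
        using coc m unfolding cocycle_def by blast
      then show "defect \<alpha> \<beta> T (of_int k) (of_int s) m = 0"
        using m by (simp add: T weights_add_of_int defect_def)
    qed (unfold defect_def T_def, (intro poly_fun_homogenize poly_fun_intros)+)
  qed
  then have part: "cocycle_identity \<alpha> \<beta> (homogenize d (p d))" if "d \<le> 2 * N" for d
    using homogeneous_parts that unfolding T_def[abs_def] by blast
  have "T 0 m = 0" for m
  proof (rule poly_fun_zero[where f = "\<lambda>m. T 0 m", OF _ infinite_weights])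
    show "poly_fun (\<lambda>m. T 0 m)"
      unfolding T_def by (intro poly_fun_homogenize poly_fun_intros)
    show "T 0 x = 0" if "x \<in> weights \<gamma>" for x
      using that T[of x 0] coc unfolding cocycle_def by simp
  qed
  moreover have "homogenize d (p d) 0 m = coeff (p d) 0 * m ^ d" for d m
  proof -
    have "homogenize d (p d) 0 m = (\<Sum>i\<le>d. if i = 0 then coeff (p d) 0 * m ^ d else 0)"
      unfolding homogenize_def by (intro sum.cong) auto
    then show ?thesis by simp
  qed
  ultimately have "\<forall>m. (\<Sum>d\<le>2*N. coeff (p d) 0 * m ^ d) = 0"
    unfolding T_def by simp
  then have p0: "coeff (p d) 0 = 0" if "d \<le> 2 * N" for d
    using polyfun_eq_0[of "\<lambda>d. coeff (p d) 0" "2 * N"] that by blast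
  have "reducible \<alpha> \<beta> T"
    unfolding T_def[abs_def]
    by (intro reducible_sum homogenize_reducible) (simp_all add: part p0 deg)
  then obtain g c where
    "\<And>k m. T k m = coboundary_of \<alpha> \<beta> g k m + (\<Sum>e | attached e \<alpha> \<beta>. c e * listed_poly e \<alpha> k m)"
    unfolding reducible_def by blast
  then show thesis
    using T by (intro that[of g c]) (simp add: listed_def)
qed

section \<open>Nontriviality of the listed cocycles\<close>

text \<open>Although a coboundary may come from an arbitrary function \<open>g\<close>, a polynomial coboundary forces \<open>g\<close> to be
polynomial. The step from \<open>m\<close> to \<open>m + 1\<close> and the step back are two linear equations for
\<open>g m\<close>, \<open>g (m + 1)\<close> with constant determinant \<open>(\<alpha> - \<beta>) (\<alpha> + \<beta> - 1)\<close>. When it vanishes because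
\<open>\<alpha> + \<beta> = 1\<close>, the three steps among \<open>m\<close>, \<open>m + 1\<close>, \<open>m + 2\<close> have the constant determinant
\<open>2 \<alpha> \<beta> (\<beta> - \<alpha>)\<close> instead.\<close>

lemma coboundary_function_polynomial:
  assumes T: "\<And>k c. poly_fun (\<lambda>m. T k (m + c))"
    and ne: "\<alpha> \<noteq> \<beta>" "\<not> (\<alpha> = 1 \<and> \<beta> = 0)" "\<not> (\<alpha> = 0 \<and> \<beta> = 1)"
    and coboundary_of: "\<And>k m. m \<in> weights \<gamma> \<Longrightarrow> T (of_int k) m = coboundary_of \<alpha> \<beta> g (of_int k) m"
  obtains G where "\<And>m. m \<in> weights \<gamma> \<Longrightarrow> g m = poly G m"
proof -
  note shift = weights_add_of_int[of _ \<gamma>]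
  have T': "poly_fun (\<lambda>m. T k (m + c))" "poly_fun (\<lambda>m. T k m)" for k c
    using T[of k c] T[of k 0] by simp_all
  have "\<exists>K Q. K \<noteq> 0 \<and> poly_fun Q \<and> (\<forall>m\<in>weights \<gamma>. K * g m = Q m)"
  proof (cases "\<alpha> + \<beta> = 1")
    case False
    define Q where "Q m = (m + 1 - \<alpha>) * T 1 m + (m + \<beta>) * T (-1) (m + 1)" for m
    have "(\<alpha> - \<beta>) * (\<alpha> + \<beta> - 1) * g m = Q m" if m: "m \<in> weights \<gamma>" for m
    proof -
      have "T 1 m = (m + \<beta>) * g (m + 1) - (m + \<alpha>) * g m"
        using coboundary_of[OF m, of 1] by (simp add: coboundary_of_def)
      moreover have "T (-1) (m + 1) = (m + 1 - \<beta>) * g m - (m + 1 - \<alpha>) * g (m + 1)"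
        using coboundary_of[OF shift[OF m, of 1], of "-1"] by (simp add: coboundary_of_def)
      ultimately show ?thesis unfolding Q_def by algebra
    qed
    moreover have "poly_fun Q"
      unfolding Q_def[abs_def] by (intro poly_fun_intros T')
    moreover have "(\<alpha> - \<beta>) * (\<alpha> + \<beta> - 1) \<noteq> 0" using False ne by simp
    ultimately show ?thesis by blast
  next
    case True
    then have \<alpha>: "\<alpha> = 1 - \<beta>" by (simp add: algebra_simps)
    define Q where "Q m = (m + \<beta>) * (m + 2 * \<beta>) * T 1 (m + 1) - (m + 1 + \<beta>) * (m + \<beta>) * T 2 m
      + (m + 1 + \<alpha>) * (m + 2 * \<beta>) * T 1 m" for m
    have "2 * \<alpha> * \<beta> * (\<beta> - \<alpha>) * g m = Q m" if m: "m \<in> weights \<gamma>" for m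
    proof -
      have "T 1 m = (m + \<beta>) * g (m + 1) - (m + \<alpha>) * g m"
        using coboundary_of[OF m, of 1] by (simp add: coboundary_of_def)
      moreover have "T 1 (m + 1) = (m + 1 + \<beta>) * g (m + 2) - (m + 1 + \<alpha>) * g (m + 1)"
        using coboundary_of[OF shift[OF m, of 1], of 1] by (simp add: coboundary_of_def add.assoc)
      moreover have "T 2 m = (m + 2 * \<beta>) * g (m + 2) - (m + 2 * \<alpha>) * g m"
        using coboundary_of[OF m, of 2] by (simp add: coboundary_of_def mult.commute)
      ultimately show ?thesis unfolding Q_def \<alpha> by algebra
    qed
    moreover have "poly_fun Q"
      unfolding Q_def[abs_def] by (intro poly_fun_intros T')
    moreover have "2 * \<alpha> * \<beta> * (\<beta> - \<alpha>) \<noteq> 0" using ne \<alpha> by auto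
    ultimately show ?thesis by blast
  qed
  then obtain K Q where K: "K \<noteq> 0" and Q: "poly_fun Q" and KQ: "\<And>m. m \<in> weights \<gamma> \<Longrightarrow> K * g m = Q m"
    by blast
  obtain P where P: "\<And>x. Q x = poly P x" using Q unfolding poly_fun_def by blast
  show thesis
  proof
    fix m assume "m \<in> weights \<gamma>"
    then have "K * g m = poly P m" using KQ P by simp
    then show "g m = poly (smult (1 / K) P) m" using K by (simp add: field_simps)
  qed
qed

text \<open>Once \<open>g\<close> is a polynomial, only its component of degree \<open>n\<close> contributes in degree \<open>n + 1\<close>, and the
determinant of the coboundary of \<open>m ^ n\<close> is zero.\<close>

lemma coboundary_imp_obstruction_eq_0:
  assumes cb: "coboundary \<alpha> \<beta> \<gamma> (\<lambda>k m. homogenize (Suc n) L (of_int k) m)"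
    and deg: "degree L \<le> Suc n" and n: "2 \<le> n" "\<alpha> - \<beta> = of_nat n"
  shows "obstruction \<beta> n L = 0"
proof -
  let ?T = "homogenize (Suc n) L"
  have \<alpha>: "\<alpha> = \<beta> + of_nat n" using n(2) by (simp add: algebra_simps)
  obtain g where g: "\<And>k m. m \<in> weights \<gamma> \<Longrightarrow> ?T (of_int k) m = coboundary_of \<alpha> \<beta> g (of_int k) m"
    using cb unfolding coboundary_def coboundary_of_def by blast
  have "\<exists>G. \<forall>m\<in>weights \<gamma>. g m = poly G m"
  proof (rule coboundary_function_polynomial[OF _ _ _ _ g])
    show "poly_fun (\<lambda>m. ?T k (m + c))" for k c
      by (intro poly_fun_homogenize poly_fun_intros)
    have "of_nat n \<noteq> (0::complex)" "of_nat n \<noteq> (1::complex)"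
      using n(1) by simp_all
    then show "\<alpha> \<noteq> \<beta>" "\<not> (\<alpha> = 1 \<and> \<beta> = 0)" unfolding \<alpha> by auto
    show "\<not> (\<alpha> = 0 \<and> \<beta> = 1)"
    proof
      assume "\<alpha> = 0 \<and> \<beta> = 1"
      then have "1 + of_nat n = (0::complex)" using \<alpha> by metis
      then have "of_nat (Suc n) = (0::complex)" by simp
      then show False unfolding of_nat_eq_0_iff by simp
    qed
  next
    fix G assume "\<And>m. m \<in> weights \<gamma> \<Longrightarrow> g m = poly G m"
    then show "\<exists>G. \<forall>m\<in>weights \<gamma>. g m = poly G m" by (intro exI[of _ G] ballI)
  qed
  then obtain G where G: "\<And>m. m \<in> weights \<gamma> \<Longrightarrow> g m = poly G m" by blast
  have T: "?T k m = coboundary_of \<alpha> \<beta> (poly G) k m" for k m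
  proof -
    have "?T k m - coboundary_of \<alpha> \<beta> (poly G) k m = 0"
    proof (rule zero_by_density[where F = "\<lambda>k s m. ?T k m - coboundary_of \<alpha> \<beta> (poly G) k m" and \<gamma> = \<gamma>])
      fix k s m assume m: "m \<in> weights \<gamma>"
      then have "m + of_int k \<in> weights \<gamma>"
        by (rule weights_add_of_int)
      then show "?T (of_int k) m - coboundary_of \<alpha> \<beta> (poly G) (of_int k) m = 0"
        using g[OF m] G m by (simp add: coboundary_of_def)
    qed (unfold coboundary_of_def, (intro poly_fun_homogenize poly_fun_intros)+)
    then show ?thesis by simp
  qed
  define M where "M = max n (degree G)"
  have G_sum: "poly G x = (\<Sum>j\<le>M. coeff G j * x ^ j)" for x
    unfolding M_def poly_altdef
    by (rule sum.mono_neutral_left) (auto intro: le_degree)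
  have "poly L k = coeff G n * poly (cob_poly \<alpha> \<beta> n) k" for k
  proof -
    define e where "e i = (case i of 0 \<Rightarrow> 0 | Suc j \<Rightarrow>
      coeff G j * poly (cob_poly \<alpha> \<beta> j) k - (if j = n then poly L k else 0))" for i
    have "(\<Sum>i\<le>Suc M. e i * c ^ i) = 0" for c
    proof -
      have "c ^ Suc n * poly L k = ?T (c * k) (c * 1)"
        by (simp only: homogenize_scale homogenize_one[OF deg])
      also have "\<dots> = coboundary_of \<alpha> \<beta> (poly G) (c * k) (c * 1)"
        by (rule T)
      also have "\<dots> = (\<Sum>j\<le>M. coeff G j * homogenize (Suc j) (cob_poly \<alpha> \<beta> j) (c * k) (c * 1))"
        unfolding homogenize_cob_poly coboundary_of_def G_sum
        by (simp add: sum_distrib_left sum_subtractf algebra_simps)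
      also have "\<dots> = (\<Sum>j\<le>M. coeff G j * poly (cob_poly \<alpha> \<beta> j) k * c ^ Suc j)"
        by (simp only: homogenize_scale homogenize_one[OF degree_cob_poly]) (simp only: mult_ac)
      finally have sum: "c ^ Suc n * poly L k
        = (\<Sum>j\<le>M. coeff G j * poly (cob_poly \<alpha> \<beta> j) k * c ^ Suc j)" .
      have "(\<Sum>i\<le>Suc M. e i * c ^ i) = (\<Sum>j\<le>M. e (Suc j) * c ^ Suc j)"
        unfolding sum.atMost_Suc_shift by (simp add: e_def)
      also have "\<dots> = (\<Sum>j\<le>M. coeff G j * poly (cob_poly \<alpha> \<beta> j) k * c ^ Suc j)
          - (\<Sum>j\<le>M. if j = n then c ^ Suc n * poly L k else 0)"
        unfolding sum_subtractf[symmetric]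
        by (intro sum.cong refl) (auto simp: e_def algebra_simps)
      also have "\<dots> = 0"
        unfolding sum[symmetric] by (simp add: M_def)
      finally show ?thesis .
    qed
    then have "\<forall>i\<le>Suc M. e i = 0"
      using polyfun_eq_0[of e "Suc M"] by blast
    then have "e (Suc n) = 0" by (simp add: M_def)
    then show ?thesis by (simp add: e_def)
  qed
  then have "L - smult (coeff G n) (cob_poly \<alpha> \<beta> n) = 0"
    by (intro poly_all_0_iff_0[THEN iffD1]) simp
  then have "obstruction \<beta> n (L - smult (coeff G n) (cob_poly \<alpha> \<beta> n)) = 0"
    by (simp add: obstruction_def)
  then show ?thesis by (simp add: obstruction_diff obstruction_cob_poly)
qed


text \<open>For \<open>\<alpha> = \<beta>\<close> the step from \<open>m\<close> to \<open>m + k\<close> and the step back combine to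
\<open>(2 m + k) (g (m + k) - g m) = 2 k\<close>, and these differences do not add up
around \<open>\<gamma>\<close>, \<open>\<gamma> + 1\<close>, \<open>\<gamma> + 2\<close>.\<close>

lemma not_coboundary_i:
  assumes "\<alpha> = \<beta>"
  shows "\<not> coboundary \<alpha> \<beta> \<gamma> (\<lambda>k m. of_int k)"
proof
  assume "coboundary \<alpha> \<beta> \<gamma> (\<lambda>k m. of_int k)"
  then obtain g where g: "\<And>k m. m \<in> weights \<gamma> \<Longrightarrow>
      of_int k = (m + \<alpha> * of_int k) * g (m + of_int k) - (m + \<alpha> * of_int k) * g m"
    unfolding coboundary_def assms by blast
  have diff: "(2 * m + of_int k) * (g (m + of_int k) - g m) = 2 * of_int k" if m: "m \<in> weights \<gamma>" for m k
  proof -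
    have "of_int k = (m + \<alpha> * of_int k) * (g (m + of_int k) - g m)"
      using g[OF m, of k] by (simp add: algebra_simps)
    moreover have "of_int k = (m + of_int k - \<alpha> * of_int k) * (g (m + of_int k) - g m)"
      using g[OF weights_add_of_int[OF m, of k], of "- k"] by (simp add: algebra_simps)
    ultimately show ?thesis by algebra
  qed
  have m: "\<gamma> \<in> weights \<gamma>"
    unfolding weights_def by (auto intro: exI[of _ 0])
  define a b c where "a = g \<gamma>" and "b = g (\<gamma> + 1)" and "c = g (\<gamma> + 2)"
  have "(2 * \<gamma> + 1) * (b - a) = 2"
    using diff[OF m, of 1] by (simp add: a_def b_def)
  moreover have "(2 * \<gamma> + 3) * (c - b) = 2"
    using diff[OF weights_add_of_int[OF m, of 1], of 1]
    by (simp add: c_def b_def add.assoc algebra_simps)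
  moreover have "(2 * \<gamma> + 2) * (c - a) = 4"
    using diff[OF m, of 2] by (simp add: c_def a_def)
  \<comment> \<open>eliminates the two independent differences between the three equations\<close>
  moreover have "4 = (2 * \<gamma> + 1) * (2 * \<gamma> + 3) * ((2 * \<gamma> + 2) * (c - a) - 4)
      - (2 * \<gamma> + 2) * (2 * \<gamma> + 3) * ((2 * \<gamma> + 1) * (b - a) - 2)
      - (2 * \<gamma> + 2) * (2 * \<gamma> + 1) * ((2 * \<gamma> + 3) * (c - b) - 2)"
    by (simp add: algebra_simps)
  ultimately have "(4::complex) = 0" by simp
  then show False by simp
qed

text \<open>A step and its reverse force \<open>a = 2 b\<close>; the cycle through \<open>\<gamma>\<close>, \<open>\<gamma> + 1\<close>, \<open>\<gamma> + 2\<close> then excludes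
nonzero \<open>b\<close>.\<close>

lemma independent_ii_iii:
  assumes "coboundary 1 0 \<gamma> (\<lambda>k m. a * (of_int k * m) + b * of_int k ^ 2)"
  shows "a = 0 \<and> b = 0"
proof -
  obtain g where g: "\<And>k m. m \<in> weights \<gamma> \<Longrightarrow>
      a * (of_int k * m) + b * of_int k ^ 2 = m * g (m + of_int k) - (m + of_int k) * g m"
    using assms unfolding coboundary_def by auto
  have m: "\<gamma> \<in> weights \<gamma>"
    unfolding weights_def by (auto intro: exI[of _ 0])
  define x y z where "x = g \<gamma>" and "y = g (\<gamma> + 1)" and "z = g (\<gamma> + 2)"
  have 1: "a * \<gamma> + b = \<gamma> * y - (\<gamma> + 1) * x"
    using g[OF m, of 1] by (simp add: x_def y_def)
  have "- a * (\<gamma> + 1) + b = (\<gamma> + 1) * x - \<gamma> * y"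
    using g[OF weights_add_of_int[OF m, of 1], of "- 1"] by (simp add: x_def y_def algebra_simps)
  with 1 have ab: "a = 2 * b" by algebra
  have 2: "a * (\<gamma> + 1) + b = (\<gamma> + 1) * z - (\<gamma> + 2) * y"
    using g[OF weights_add_of_int[OF m, of 1], of 1] by (simp add: z_def y_def add.assoc)
  have 3: "2 * a * \<gamma> + 4 * b = \<gamma> * z - (\<gamma> + 2) * x"
    using g[OF m, of 2] by (simp add: z_def x_def algebra_simps)
  have "2 * b = 0" using 1 2 3 unfolding ab by algebra
  then show ?thesis using ab by simp
qed

lemma not_coboundary_listed:
  assumes e: "attached e \<alpha> \<beta>"
  shows "\<not> coboundary \<alpha> \<beta> \<gamma> (listed e \<alpha>)"
proof (cases "2 \<le> listed_index e")
  case True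
  have "listed e \<alpha> = (\<lambda>k m. homogenize (Suc (listed_index e)) (listed_coeffs e \<alpha>) (of_int k) m)"
    by (simp add: listed_def listed_poly_homogenize)
  then show ?thesis
    using obstruction_listed[OF e True]
      coboundary_imp_obstruction_eq_0[OF _ degree_listed_coeffs True attached_index[OF e]] by metis
next
  case False
  then consider "e = Entry_i" | "e = Entry_ii" | "e = Entry_iii" by (cases e) auto
  then show ?thesis
  proof cases
    case 1
    then show ?thesis using e not_coboundary_i[of \<alpha> \<beta> \<gamma>] by (simp add: listed_def)
  next
    case 2
    then show ?thesis using e independent_ii_iii[of \<gamma> 1 0] by (auto simp: listed_def)
  next
    case 3
    then show ?thesis using e independent_ii_iii[of \<gamma> 0 1] by (auto simp: listed_def)
  qed
qed

section \<open>The classification theorem\<close>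

theorem mainTheorem2:
  fixes \<alpha> \<beta> \<gamma> :: complex
  shows "(\<forall>e. attached e \<alpha> \<beta> \<longrightarrow>
            cocycle \<alpha> \<beta> \<gamma> (listed e \<alpha>) \<and> \<not> trivial_cocycle \<alpha> \<beta> \<gamma> (listed e \<alpha>))
       \<and> (\<alpha> = 1 \<and> \<beta> = 0 \<longrightarrow>
            (\<forall>a b :: complex.
               coboundary \<alpha> \<beta> \<gamma> (\<lambda>k m. a * listed Entry_ii \<alpha> k m + b * listed Entry_iii \<alpha> k m)
               \<longrightarrow> a = 0 \<and> b = 0))
       \<and> (\<forall>\<tau>. polynomial_cocycle \<alpha> \<beta> \<gamma> \<tau> \<longrightarrow>
            (\<exists>c :: entry \<Rightarrow> complex.
               equivalent_cocycles \<alpha> \<beta> \<gamma> \<tau>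
                 (\<lambda>k m. \<Sum>e | attached e \<alpha> \<beta>. c e * listed e \<alpha> k m)))
       \<and> ((\<nexists>e. attached e \<alpha> \<beta>) \<longrightarrow>
            (\<forall>\<tau>. polynomial_cocycle \<alpha> \<beta> \<gamma> \<tau> \<longrightarrow> trivial_cocycle \<alpha> \<beta> \<gamma> \<tau>))"
proof -
  have classified: "\<exists>c. equivalent_cocycles \<alpha> \<beta> \<gamma> \<tau>
      (\<lambda>k m. \<Sum>e | attached e \<alpha> \<beta>. c e * listed e \<alpha> k m)"
    if \<tau>: "polynomial_cocycle \<alpha> \<beta> \<gamma> \<tau>" for \<tau>
  proof -
    obtain g c where gc: "\<And>k m. m \<in> weights \<gamma> \<Longrightarrow>
      \<tau> k m = coboundary_of \<alpha> \<beta> g (of_int k) m + (\<Sum>e | attached e \<alpha> \<beta>. c e * listed e \<alpha> k m)"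
      using polynomial_cocycle_reducible[OF \<tau>] by blast
    have "coboundary \<alpha> \<beta> \<gamma> (\<lambda>k m. \<tau> k m - (\<Sum>e | attached e \<alpha> \<beta>. c e * listed e \<alpha> k m))"
      unfolding coboundary_def by (intro exI[of _ g]) (simp add: gc coboundary_of_def)
    then show ?thesis
      using \<tau> cocycle_listed_sum[of \<alpha> \<beta> \<gamma> c]
      unfolding equivalent_cocycles_def polynomial_cocycle_def by blast
  qed
  have "trivial_cocycle \<alpha> \<beta> \<gamma> \<tau>"
    if none: "\<nexists>e. attached e \<alpha> \<beta>" and \<tau>: "polynomial_cocycle \<alpha> \<beta> \<gamma> \<tau>" for \<tau>
    using classified[OF \<tau>] none unfolding equivalent_cocycles_def trivial_cocycle_def by simp
  moreover have "a = 0 \<and> b = 0" if "\<alpha> = 1 \<and> \<beta> = 0"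
    "coboundary \<alpha> \<beta> \<gamma> (\<lambda>k m. a * listed Entry_ii \<alpha> k m + b * listed Entry_iii \<alpha> k m)" for a b
    using that independent_ii_iii[of \<gamma> a b] by (simp add: listed_def)
  ultimately show ?thesis
    using classified cocycle_listed not_coboundary_listed unfolding trivial_cocycle_def by blast
qed

end
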